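(* Let $n\in\mathbb{N}$ and let $\alpha\in(0,1)$ have bounded continued fraction coefficients. Then the star discrepancy of the first $N$ elements of the sequence $(z_k(n))_{k\geq 0}$ satisfies \[ N D_N^*(z_k(n)) \ll_n N^{a(n)+\varepsilon} \] for all $\varepsilon>0$, where \[ a(n)=\log_{2^n}\left(\cot\frac{\pi}{2(2^n+1)}\right). \]
   Context: Perturbed Halton--Kronecker sequence: Fix $n\in\mathbb{N}$ and let $\boldsymbol{c}=(c_0,c_1,c_2,\ldots)\in\{0,1\}^{\mathbb{N}_0}$ be the periodic sequence with period $n$ given by $c_j=1$ if $n\mid j$ and $c_j=0$ otherwise (i.e. $\boldsymbol c=(10\ldots0\,10\ldots0\ldots)$ with blocks of length $n$). Let $C$ be the infinite $\{0,1\}$-matrix equal to the identity except that its first row is $\boldsymbol c$. For a non-negative integer $k$ with binary expansion $k=k_0+k_12+k_22^2+\cdots$ put $\boldsymbol k=(k_0,k_1,\ldots)$, compute $(y_0,y_1,\ldots)=C\boldsymbol k^{\top}$ modulo $2$ (so $y_0\equiv\sum_j c_jk_j \pmod 2$ and $y_i=k_i$ for $i\ge1$), and set $x_k(n)=\sum_{i\ge0}y_i2^{-i-1}$. For a real $\alpha$ let $z_k(n)=(x_k(n),\{k\alpha\})\in[0,1)^2$, where $\{t\}$ is the fractional part. Star discrepancy: for a sequence $\mathcal S=(s_0,s_1,\ldots)$ in $[0,1)^2$, $D_N^*(\mathcal S)=\sup_{\boldsymbol x=(x_1,x_2)\in(0,1]^2}\frac1N\left|\#\{0\le k<N: s_k\in[0,x_1)\times[0,x_2)\}-Nx_1x_2\right|$.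 Notation: $A(N)\ll_X B(N)$ means $|A(N)|\le c_X|B(N)|$ for all sufficiently large $N$, with a constant $c_X>0$ depending only on the parameters $X$. *)

theory Defs
  imports "HOL-Analysis.Analysis"
begin

definition binary_digit :: "nat \<Rightarrow> nat \<Rightarrow> nat" where
  "binary_digit k j = (k div 2 ^ j) mod 2"

definition row_c :: "nat \<Rightarrow> nat \<Rightarrow> nat" where
  "row_c n j = (if n dvd j then 1 else 0)"

definition perturbed_matrix :: "nat \<Rightarrow> nat \<Rightarrow> nat \<Rightarrow> nat" where
  "perturbed_matrix n i j = (if i = 0 then row_c n j else if i = j then 1 else 0)"

text \<open>
  The matrix-vector product modulo 2. A row of an infinite matrix may have infinitely many
  nonzero entries, so the sum runs over the (finite) support of the digit vector of \<open>k\<close>.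
\<close>
definition digital_output :: "(nat \<Rightarrow> nat \<Rightarrow> nat) \<Rightarrow> nat \<Rightarrow> nat \<Rightarrow> nat" where
  "digital_output C k i = (\<Sum>j\<in>{j. binary_digit k j \<noteq> 0}. C i j * binary_digit k j) mod 2"

definition perturbed_vdc :: "nat \<Rightarrow> nat \<Rightarrow> real" where
  "perturbed_vdc n k = (\<Sum>i. real (digital_output (perturbed_matrix n) k i) / 2 ^ (i + 1))"

definition perturbed_halton_kronecker :: "nat \<Rightarrow> real \<Rightarrow> nat \<Rightarrow> real \<times> real" where
  "perturbed_halton_kronecker n \<alpha> k = (perturbed_vdc n k, frac (real k * \<alpha>))"

definition star_discrepancy :: "(nat \<Rightarrow> real \<times> real) \<Rightarrow> nat \<Rightarrow> real" where
  "star_discrepancy s N =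
     (SUP (x1, x2) \<in> {0<..1} \<times> {0<..1}.
        1 / real N * \<bar>real (card {k. k < N \<and> s k \<in> {0..<x1} \<times> {0..<x2}}) - real N * x1 * x2\<bar>)"

text \<open>
  Regular continued fraction: the complete quotients are \<open>\<alpha>\<^sub>0 = \<alpha>\<close> and
  \<open>\<alpha>\<^sub>i\<^sub>+\<^sub>1 = 1 / (\<alpha>\<^sub>i - \<lfloor>\<alpha>\<^sub>i\<rfloor>)\<close>, and the coefficients are their integer parts.
  For irrational \<open>\<alpha>\<close> no denominator vanishes; for rational \<open>\<alpha>\<close> the expansion terminates and
  the values after that point (\<open>1 / 0 = 0\<close>) are meaningless.
\<close>
primrec complete_quotient :: "real \<Rightarrow> nat \<Rightarrow> real" where
  "complete_quotient \<alpha> 0 = \<alpha>"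
| "complete_quotient \<alpha> (Suc i) = 1 / frac (complete_quotient \<alpha> i)"

definition cf_coeff :: "real \<Rightarrow> nat \<Rightarrow> int" where
  "cf_coeff \<alpha> i = \<lfloor>complete_quotient \<alpha> i\<rfloor>"

text \<open>
  As usual in this context, an unending expansion is meant, i.e. \<open>\<alpha>\<close> is irrational. Otherwise
  \<open>frac (k * \<alpha>)\<close> would be periodic in \<open>k\<close>.
\<close>
definition bounded_cf_coeffs :: "real \<Rightarrow> bool" where
  "bounded_cf_coeffs \<alpha> \<longleftrightarrow> \<alpha> \<notin> \<rat> \<and> (\<exists>M. \<forall>i. cf_coeff \<alpha> i \<le> M)"

definition discrepancy_exponent :: "nat \<Rightarrow> real" where
  "discrepancy_exponent n = log (2 ^ n) (cot (pi / (2 * (2 ^ n + 1))))"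

end

theory Submission
  imports Defs
begin

text \<open>
  The condition \<open>x\<^sub>k \<in> [b / 2\<^sup>l, (b + 1) / 2\<^sup>l)\<close> fixes the digits \<open>k\<^sub>1, \<dots>, k\<^sub>l\<^sub>-\<^sub>1\<close> and the parity of
  \<open>\<Sum>c\<^sub>jk\<^sub>j\<close>, so its indicator is a sum over two residue classes modulo \<open>2\<^sup>l\<close> of \<open>(1 \<plusminus> w k) / 2\<close> with the
  digit character \<open>w k = (-1) ^ (\<Sum>c\<^sub>jk\<^sub>j)\<close>. The untwisted part is a Kronecker sequence along an
  arithmetic progression; as \<open>\<alpha>\<close> is badly approximable, it contributes only \<open>O(\<surd>N)\<close>. In the twisted
  part, \<open>\<alpha>\<close> is replaced by a rational \<open>p / Q\<close> with \<open>Q \<approx> N\<^sup>2\<close>, which changes at most two of the points,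
  and the indicator of \<open>[0, t)\<close> is expanded in a finite Fourier series on \<open>\<int> / Q\<close>, whose coefficients
  have absolute sum \<open>O(ln Q)\<close>. There remain exponential sums twisted by \<open>w\<close>; they factor into lacunary
  products of \<open>\<bar>tan (2\<^sup>n\<^sup>jx)\<bar>\<close> up to boundary terms. A factor exceeding \<open>\<kappa> = cot (\<pi> / (2 (2\<^sup>n + 1)))\<close>
  is compensated by its successor, so the products are \<open>O(\<kappa> ^ L)\<close> uniformly in \<open>x\<close>, where
  \<open>\<kappa> = 2 powr (n a(n))\<close>.
\<close>

section \<open>Bounded continued fraction coefficients\<close>

lemma complete_quotient_irrational:
  fixes \<alpha> :: real
  assumes "\<alpha> \<notin> \<rat>"
  shows "complete_quotient \<alpha> i \<notin> \<rat>"
proof (induction i)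
  case (Suc i)
  show ?case
  proof
    assume "complete_quotient \<alpha> (Suc i) \<in> \<rat>"
    then have "frac (complete_quotient \<alpha> i) \<in> \<rat>"
      using Rats_inverse by (fastforce simp: divide_inverse)
    then have "frac (complete_quotient \<alpha> i) + of_int \<lfloor>complete_quotient \<alpha> i\<rfloor> \<in> \<rat>"
      by (intro Rats_add) auto
    then show False using Suc by (simp add: frac_def)
  qed
qed (use assms in simp)

lemma frac_irrational_bounds:
  fixes x :: real
  assumes "x \<notin> \<rat>"
  shows "0 < frac x" "frac x < 1"
proof -
  have "frac x \<noteq> 0" using assms by (auto simp: frac_eq_0_iff elim: Ints_cases)
  then show "0 < frac x" using frac_ge_0[of x] by linarith
  show "frac x < 1" by (rule frac_lt_1)
qed

text \<open>
  The map \<open>(x, g) \<mapsto> (1 / (x - \<lfloor>x\<rfloor>), 1 / (g + \<lfloor>x\<rfloor>))\<close> is the natural extension of the Gauss map;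
  \<open>\<bar>q x - p\<bar> (p + q g) / (x + g)\<close> is invariant when \<open>(q, p)\<close> is replaced by \<open>(p - \<lfloor>x\<rfloor> q, q)\<close>.
\<close>

lemma complete_quotient_form_bound:
  fixes p q :: int and \<alpha> g M :: real
  assumes irr: "\<alpha> \<notin> \<rat>" and bd: "\<And>i. complete_quotient \<alpha> i \<le> M" and M: "M \<ge> 1"
    and i: "i \<ge> 1" and g: "1 / (M + 1) \<le> g" "g \<le> 1"
    and pq: "q \<ge> 0" "p \<ge> 0" "q \<noteq> 0 \<or> p \<noteq> 0"
  shows "(1 / (M + 1) ^ 3) * (complete_quotient \<alpha> i + g)
           \<le> \<bar>q * complete_quotient \<alpha> i - p\<bar> * (p + q * g)"
  using i g pq
\<comment> \<open>The Euclidean step replaces \<open>q\<close> by \<open>p' = p - a * q\<close>.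
  This is a smaller positive number only if \<open>0 < p' < q\<close>; the other ranges of
  \<open>p'\<close> are settled directly.\<close>
proof (induction "nat q" arbitrary: q p i g rule: less_induct)
  case less
  define x where "x = complete_quotient \<alpha> i"
  define x' where "x' = complete_quotient \<alpha> (Suc i)"
  define x'' where "x'' = complete_quotient \<alpha> (Suc (Suc i))"
  define a where "a = \<lfloor>x\<rfloor>"
  define r where "r = frac x"
  define p' where "p' = p - a * q"
  have gt1: "complete_quotient \<alpha> (Suc j) > 1" for j
    using frac_irrational_bounds[OF complete_quotient_irrational[OF irr, of j]] by simp
  have x1: "x > 1" using gt1[of "i - 1"] less.prems(1) by (simp add: x_def)
  then have a1: "a \<ge> 1" by (simp add: a_def)
  have r: "0 < r" "r < 1"
    using frac_irrational_bounds[OF complete_quotient_irrational[OF irr, of i]]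
    by (auto simp: r_def x_def)
  have xr: "x = a + r" by (simp add: r_def a_def frac_def)
  have x': "x' = 1 / r" by (simp add: x'_def r_def x_def)
  have xM: "x \<le> M" "x' \<le> M" "x'' \<le> M" unfolding x_def x'_def x''_def by (rule bd)+
  have rM: "r \<ge> 1 / (M + 1)"
  proof -
    have "1 \<le> M * r" using xM(2) r x' by (simp add: field_simps)
    then show ?thesis using M r by (simp add: field_simps)
  qed
  \<comment> \<open>\<open>r\<close> stays away from 1 because \<open>x' = 1 / r\<close> does: the
    fractional part of \<open>x'\<close> is the reciprocal of \<open>x''\<close>, hence at least
    \<open>1 / M\<close>.\<close>
  have omr: "1 - r \<ge> 1 / (M + 1) ^ 2"
  proof -
    have fr: "0 < frac x'"
      using frac_irrational_bounds[OF complete_quotient_irrational[OF irr, of "Suc i"]]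
      by (simp add: x'_def)
    have "1 / frac x' \<le> M" using xM(3) by (simp add: x''_def x'_def)
    then have "1 / M \<le> frac x'" using fr M by (simp add: field_simps)
    moreover have "x' > 1" using gt1 by (simp add: x'_def)
    then have "frac x' \<le> x' - 1" by (simp add: frac_def)
    ultimately have "1 / M \<le> x' - 1" by linarith
    then have "1 / M * (1 / M) \<le> (x' - 1) * r"
    proof (intro mult_mono)
      show "1 / M \<le> r" using xM(2) r M x' by (simp add: field_simps)
    qed (use M \<open>x' > 1\<close> in auto)
    also have "(x' - 1) * r = 1 - r" using r x' by (simp add: field_simps)
    finally have "1 / M ^ 2 \<le> 1 - r" by (simp add: power2_eq_square)
    moreover have "1 / (M + 1) ^ 2 \<le> 1 / M ^ 2"
      using M by (intro divide_left_mono power_mono) auto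
    ultimately show ?thesis by linarith
  qed
  \<comment> \<open>\<open>x + g \<le> M + 1\<close> uses up one of the three powers, so in the
    direct cases the product on the right need only reach \<open>1 / (M + 1) ^ 2\<close>.\<close>
  have lhs: "(1 / (M + 1) ^ 3) * (x + g) \<le> 1 / (M + 1) ^ 2"
  proof -
    have "(1 / (M + 1) ^ 3) * (x + g) \<le> (1 / (M + 1) ^ 3) * (M + 1)"
      using xM less.prems M by (intro mult_left_mono) auto
    also have "\<dots> = 1 / ((M + 1) ^ 2 * (M + 1)) * (M + 1)"
      by (simp only: power3_eq_cube power2_eq_square)
    also have "\<dots> = 1 / (M + 1) ^ 2" using M by simp
    finally show ?thesis .
  qed
  have g0: "g > 0" using less.prems(2) M by (smt (verit) divide_pos_pos)
  have le1: "1 / (M + 1) ^ 2 \<le> 1" using M by simp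
  have split: "q * x - p = q * r - p'" by (simp add: xr p'_def algebra_simps)
  have key: "(1 / (M + 1) ^ 3) * (x + g) \<le> \<bar>q * x - p\<bar> * (p + q * g)"
  proof (cases "q = 0")
    case True
    then have "p \<ge> 1" using less.prems by auto
    then have "real_of_int p * real_of_int p \<ge> 1 * 1" by (intro mult_mono) auto
    then show ?thesis using True lhs le1 \<open>p \<ge> 1\<close> by simp
  next
    case False
    then have q1: "q \<ge> 1" using less.prems by auto
    consider "p' \<le> 0" | "p' \<ge> q" | "0 < p'" "p' < q" by linarith
    then show ?thesis
    proof cases
      case 1
      have "real_of_int q * r \<ge> 1 * r" using q1 r by (intro mult_right_mono) auto
      then have "\<bar>q * x - p\<bar> \<ge> 1 / (M + 1)"
        unfolding split using 1 rM by linarith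
      moreover have "real_of_int q * g \<ge> 1 * g" using q1 g0 by (intro mult_right_mono) auto
      then have "p + q * g \<ge> 1 / (M + 1)" using less.prems by linarith
      ultimately have "1 / (M + 1) * (1 / (M + 1)) \<le> \<bar>q * x - p\<bar> * (p + q * g)"
        using M by (intro mult_mono) auto
      then show ?thesis using lhs by (simp add: power2_eq_square)
    next
      case 2
      have "q * r \<le> q - (1 - r)"
      proof -
        have "1 * (1 - r) \<le> real_of_int q * (1 - r)" using q1 r by (intro mult_right_mono) auto
        then show ?thesis by (simp add: algebra_simps)
      qed
      then have A: "\<bar>q * x - p\<bar> \<ge> 1 / (M + 1) ^ 2"
        unfolding split using 2 omr by linarith
      have "a * q \<ge> 0" using a1 q1 by simp
      then have "p \<ge> 1" using 2 q1 by (simp add: p'_def)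
      moreover have "q * g \<ge> 0" using q1 g0 by simp
      ultimately have "p + q * g \<ge> 1" by linarith
      with A have "1 / (M + 1) ^ 2 * 1 \<le> \<bar>q * x - p\<bar> * (p + q * g)"
        using M by (intro mult_mono) auto
      then show ?thesis using lhs by simp
    next
      case 3
      define g' where "g' = 1 / (g + a)"
      have aM: "a \<le> M" using xM r xr by linarith
      have ag: "g + a > 0" using g0 a1 by linarith
      have "(1 / (M + 1) ^ 3) * (complete_quotient \<alpha> (Suc i) + g')
              \<le> \<bar>p' * complete_quotient \<alpha> (Suc i) - q\<bar> * (q + p' * g')"
      proof (rule less.hyps)
        show "nat p' < nat q" using 3 by simp
        show "1 / (M + 1) \<le> g'" unfolding g'_def
          using less.prems aM ag M by (intro divide_left_mono) auto
        show "g' \<le> 1" unfolding g'_def using ag a1 g0 by (simp add: field_simps)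
      qed (use 3 q1 in auto)
      \<comment> \<open>Multiplying by \<open>r * (g + a)\<close> undoes the change of variables on
        both sides, since \<open>x' * r = 1\<close> and \<open>g' * (g + a) = 1\<close>.\<close>
      then have "(1 / (M + 1) ^ 3) * (x' + g') * (r * (g + a))
              \<le> \<bar>p' * x' - q\<bar> * (q + p' * g') * (r * (g + a))"
        unfolding x'_def using r ag by (intro mult_right_mono) auto
      moreover have "(x' + g') * (r * (g + a)) = (x' * r) * (g + a) + (g' * (g + a)) * r"
        by (simp add: algebra_simps)
      then have "(x' + g') * (r * (g + a)) = x + g"
        using r ag by (simp add: x' g'_def xr)
      moreover have "\<bar>p' * x' - q\<bar> * r = \<bar>q * x - p\<bar>"
      proof -
        have "\<bar>p' * x' - q\<bar> * r = \<bar>(p' * x' - q) * r\<bar>" using r by (simp add: abs_mult)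
        also have "(p' * x' - q) * r = - (q * r - p')" using r by (simp add: x' field_simps)
        finally show ?thesis unfolding split by simp
      qed
      moreover have "(q + p' * g') * (g + a) = p + q * g"
        using ag unfolding g'_def p'_def by (simp add: field_simps)
      ultimately show ?thesis by (metis (no_types, opaque_lifting) mult.assoc mult.commute)
    qed
  qed
  then show ?case by (simp add: x_def)
qed

text \<open>The form bound is used at the first complete quotient \<open>1 / \<alpha>\<close> with
  \<open>g = 1\<close> and with the roles of \<open>p\<close> and \<open>q\<close> exchanged. It
  covers \<open>0 < p \<le> q\<close>; for other \<open>p\<close> the distance is at least
  \<open>\<alpha>\<close> or 1.\<close>

lemma bounded_cf_coeffs_badly_approximable:
  fixes \<alpha> :: real
  assumes "0 < \<alpha>" "\<alpha> < 1" "bounded_cf_coeffs \<alpha>"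
  obtains c :: real where "c > 0" "\<And>(q::nat) (p::int). q \<ge> (1::nat) \<Longrightarrow> c / q \<le> \<bar>q * \<alpha> - p\<bar>"
proof -
  from assms(3) obtain M0 where irr: "\<alpha> \<notin> \<rat>" and M0: "\<And>i. cf_coeff \<alpha> i \<le> M0"
    by (auto simp: bounded_cf_coeffs_def)
  define M where "M = max 1 (real_of_int M0 + 1)"
  have M: "M \<ge> 1" by (simp add: M_def)
  have bd: "complete_quotient \<alpha> i \<le> M" for i
    using M0[of i] unfolding cf_coeff_def M_def by linarith
  define d where "d = 1 / (M + 1) ^ 3"
  have d: "0 < d" "d \<le> 1" using M by (auto simp: d_def)
  \<comment> \<open>The factor \<open>\<alpha>\<close> comes from clearing
    \<open>1 / \<alpha>\<close>, the 2 from \<open>q + p \<le> 2 * q\<close>.\<close>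
  define c where "c = \<alpha> * d / 2"
  have c: "0 < c" "c \<le> \<alpha>" "c \<le> 1"
  proof -
    have "\<alpha> * d \<le> \<alpha>" "\<alpha> * d > 0" using assms d by (auto simp: mult_left_le)
    then show "0 < c" "c \<le> \<alpha>" "c \<le> 1" using assms unfolding c_def by linarith+
  qed
  have "c / q \<le> \<bar>q * \<alpha> - p\<bar>" if q: "q \<ge> 1" for q :: nat and p :: int
  proof -
    have cq: "c / q \<le> c" using q c by (simp add: field_simps)
    consider "p \<le> 0" | "p > int q" | "0 < p" "p \<le> int q" by linarith
    then show ?thesis
    proof cases
      case 1
      have "q * \<alpha> \<ge> 1 * \<alpha>" using q assms by (intro mult_right_mono) auto
      then show ?thesis using 1 cq c by linarith
    next
      case 2
      have "q * \<alpha> \<le> q" using assms by (simp add: mult_left_le)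
      then show ?thesis using 2 cq c by linarith
    next
      case 3
      have fr: "frac \<alpha> = \<alpha>" using assms by (simp add: frac_eq)
      have "d * (1 / \<alpha> + 1) \<le> \<bar>p * (1 / \<alpha>) - q\<bar> * (q + p * 1)"
        using complete_quotient_form_bound[OF irr bd M, of 1 1 p "int q"] 3 M fr
        by (simp add: d_def)
      moreover have "q + p * 1 \<le> real (2 * q)" using 3 by simp
      then have "\<bar>p * (1 / \<alpha>) - q\<bar> * (q + p * 1) \<le> \<bar>p * (1 / \<alpha>) - q\<bar> * real (2 * q)"
        by (intro mult_left_mono) auto
      moreover have "d * 1 \<le> d * (1 / \<alpha> + 1)" using d assms by (intro mult_left_mono) auto
      ultimately have "\<alpha> * d \<le> \<alpha> * (\<bar>p * (1 / \<alpha>) - q\<bar> * real (2 * q))"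
        using assms by (intro mult_left_mono) auto
      also have "\<dots> = \<bar>\<alpha> * (p * (1 / \<alpha>) - q)\<bar> * real (2 * q)"
        using assms by (simp add: abs_mult)
      also have "\<alpha> * (p * (1 / \<alpha>) - q) = - (q * \<alpha> - p)"
        using assms by (simp add: field_simps)
      finally have "\<alpha> * d \<le> \<bar>q * \<alpha> - p\<bar> * real (2 * q)" by (simp only: abs_minus_cancel)
      then show ?thesis using q by (simp add: c_def field_simps)
    qed
  qed
  with c(1) show ?thesis by (intro that[of c]) auto
qed

section \<open>Kronecker sequences\<close>

text \<open>Counting fractional parts below \<open>t\<close> becomes a difference of two floor sums.
  These are explicit for rational rotations and monotone under perturbation.\<close>

lemma of_bool_frac_less:
  fixes x t :: real
  assumes "0 \<le> t" "t \<le> 1"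
  shows "(of_bool (frac x < t) :: real) = of_int (\<lfloor>x\<rfloor> - \<lfloor>x - t\<rfloor>)"
proof (cases "frac x < t")
  case True
  then have "\<lfloor>x - t\<rfloor> = \<lfloor>x\<rfloor> - 1"
    using assms unfolding frac_def by (intro floor_unique) (simp, linarith+)
  then show ?thesis using True by simp
next
  case False
  then have "\<lfloor>x - t\<rfloor> = \<lfloor>x\<rfloor>"
    using assms unfolding frac_def by (intro floor_unique) linarith+
  then show ?thesis using False by simp
qed

text \<open>As \<open>p\<close> is invertible modulo \<open>q\<close>, the remainders of
  \<open>\<lfloor>q * \<gamma>\<rfloor> + m * p\<close> run through all residues once, so their sum
  does not depend on \<open>\<gamma>\<close>. One \<open>d\<close> serves every
  \<open>\<gamma>\<close> and cancels in differences.\<close>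

lemma sum_floor_arith_progression:
  fixes p :: int and q :: nat
  assumes "coprime p (int q)" "q > 0"
  obtains d :: int where "\<And>\<gamma>::real. (\<Sum>m<q. \<lfloor>\<gamma> + real m * p / q\<rfloor>) = \<lfloor>q * \<gamma>\<rfloor> + d"
proof -
  define D where "D = (\<Sum>m<q. int m * p) - \<Sum>{0..<int q}"
  have "int q * (\<Sum>m<q. \<lfloor>\<gamma> + real m * p / q\<rfloor>) = int q * \<lfloor>q * \<gamma>\<rfloor> + D" for \<gamma> :: real
  proof -
    define b where "b = \<lfloor>q * \<gamma>\<rfloor>"
    have fl: "\<lfloor>\<gamma> + real m * p / q\<rfloor> = (b + int m * p) div int q" for m
    proof -
      have "\<gamma> + real m * p / q = (q * \<gamma> + of_int (int m * p)) / of_int (int q)"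
        using assms by (simp add: field_simps)
      also have "\<lfloor>\<dots>\<rfloor> = \<lfloor>q * \<gamma> + of_int (int m * p)\<rfloor> div int q"
        by (rule floor_divide_real_eq_div) simp
      also have "\<lfloor>q * \<gamma> + of_int (int m * p)\<rfloor> = b + int m * p"
        unfolding b_def by (rule floor_add_int[symmetric])
      finally show ?thesis .
    qed
    have inj: "inj_on (\<lambda>m. (b + int m * p) mod int q) {..<q}"
    proof (rule inj_onI)
      fix m m' assume m: "m \<in> {..<q}" "m' \<in> {..<q}"
        and eq: "(b + int m * p) mod int q = (b + int m' * p) mod int q"
      then have "int q dvd (int m - int m') * p"
        by (simp add: mod_eq_dvd_iff algebra_simps)
      then have "int q dvd int m - int m'"
        using assms by (simp add: coprime_dvd_mult_left_iff coprime_commute)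
      then show "m = m'" using m
        using dvd_imp_le_int[of "int m - int m'" "int q"] by (cases "m = m'") auto
    qed
    moreover have "(\<lambda>m. (b + int m * p) mod int q) ` {..<q} \<subseteq> {0..<int q}"
      using assms by auto
    ultimately have "(\<lambda>m. (b + int m * p) mod int q) ` {..<q} = {0..<int q}"
      by (intro card_subset_eq) (auto simp: card_image)
    then have "(\<Sum>m<q. (b + int m * p) mod int q) = \<Sum>{0..<int q}"
      using sum.reindex[OF inj, of id] by simp
    moreover have "int q * (\<Sum>m<q. \<lfloor>\<gamma> + real m * p / q\<rfloor>)
        = (\<Sum>m<q. (b + int m * p) - (b + int m * p) mod int q)"
      unfolding fl sum_distrib_left by (intro sum.cong) (auto simp: minus_mod_eq_mult_div)
    ultimately show ?thesis by (simp add: D_def b_def sum_subtractf sum.distrib)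
  qed
  note * = this
  \<comment> \<open>The case \<open>\<gamma> = 0\<close> shows that \<open>q\<close> divides
    \<open>D\<close>, so the identity can be divided by \<open>q\<close> within the
    integers.\<close>
  have "D = int q * ((\<Sum>m<q. \<lfloor>0 + real m * p / q\<rfloor>))" using *[of 0] by simp
  then have "int q * (\<Sum>m<q. \<lfloor>\<gamma> + real m * p / q\<rfloor>)
      = int q * (\<lfloor>q * \<gamma>\<rfloor> + (\<Sum>m<q. \<lfloor>0 + real m * p / q\<rfloor>))" for \<gamma> :: real
    using *[of \<gamma>] by (simp add: algebra_simps)
  then show ?thesis using assms that by simp
qed

text \<open>For \<open>m < q\<close> the point \<open>m * \<theta>\<close> is within
  \<open>1 / q\<close> of \<open>m * p / q\<close>. Shifting \<open>\<gamma>\<close> by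
  \<open>1 / q\<close> up or down therefore encloses each floor sum and moves
  \<open>q * \<gamma>\<close> by just 1; rounding accounts for the rest of the 4.\<close>

lemma kronecker_block_count:
  fixes p :: int and q K :: nat and \<theta> \<beta> t :: real
  assumes "coprime p (int q)" "q > 0" "\<bar>q * \<theta> - p\<bar> \<le> 1 / q" "0 \<le> t" "t \<le> 1"
  shows "\<bar>(\<Sum>m<q. of_bool (frac (\<beta> + m * \<theta>) < t)) - q * t\<bar> \<le> 4"
proof -
  obtain d where d: "\<And>\<gamma>::real. (\<Sum>m<q. \<lfloor>\<gamma> + real m * p / q\<rfloor>) = \<lfloor>q * \<gamma>\<rfloor> + d"
    using sum_floor_arith_progression[OF assms(1,2)] by blast
  have near: "\<bar>m * \<theta> - m * p / q\<bar> \<le> 1 / q" if "m < q" for m :: nat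
  proof -
    have "m * \<theta> - m * p / q = (m / q) * (q * \<theta> - p)" using assms by (simp add: field_simps)
    then have "\<bar>m * \<theta> - m * p / q\<bar> = (m / q) * \<bar>q * \<theta> - p\<bar>" by (simp add: abs_mult)
    also have "\<dots> \<le> 1 * (1 / q)" using that assms by (intro mult_mono) auto
    finally show ?thesis by simp
  qed
  have up: "(\<Sum>m<q. \<lfloor>\<gamma> + m * \<theta>\<rfloor>) \<le> \<lfloor>q * (\<gamma> + 1 / q)\<rfloor> + d" for \<gamma> :: real
    unfolding d[symmetric]
  proof (intro sum_mono floor_mono)
    fix m assume "m \<in> {..<q}"
    then show "\<gamma> + m * \<theta> \<le> \<gamma> + 1 / q + real m * p / q" using near[of m] by auto
  qed
  have low: "(\<Sum>m<q. \<lfloor>\<gamma> + m * \<theta>\<rfloor>) \<ge> \<lfloor>q * (\<gamma> - 1 / q)\<rfloor> + d" for \<gamma> :: real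
    unfolding d[symmetric]
  proof (intro sum_mono floor_mono)
    fix m assume "m \<in> {..<q}"
    then show "\<gamma> + m * \<theta> \<ge> \<gamma> - 1 / q + real m * p / q" using near[of m] by auto
  qed
  have e: "q * (\<gamma> + 1 / q) = q * \<gamma> + 1" "q * (\<gamma> - 1 / q) = q * \<gamma> - 1" for \<gamma> :: real
    using assms by (auto simp: field_simps)
  have "(\<Sum>m<q. of_bool (frac (\<beta> + m * \<theta>) < t)) =
      real_of_int ((\<Sum>m<q. \<lfloor>\<beta> + m * \<theta>\<rfloor>) - (\<Sum>m<q. \<lfloor>(\<beta> - t) + m * \<theta>\<rfloor>))"
    unfolding of_bool_frac_less[OF assms(4,5)] by (simp add: sum_subtractf algebra_simps)
  moreover have "q * (\<beta> - t) = q * \<beta> - q * t" by (simp add: algebra_simps)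
  ultimately show ?thesis
    using up[of \<beta>] low[of \<beta>] up[of "\<beta> - t"] low[of "\<beta> - t"] unfolding e by linarith
qed

lemma sum_lessThan_add:
  fixes f :: "nat \<Rightarrow> 'a::comm_monoid_add"
  shows "(\<Sum>m<a + b. f m) = (\<Sum>m<a. f m) + (\<Sum>m<b. f (a + m))"
  by (induction b) (simp_all add: add.assoc)

text \<open>Full periods of length \<open>q\<close> cost 4 each, the incomplete last one at most
  \<open>q\<close>. The start \<open>\<beta>\<close> varies in the induction since each removed
  period advances it by \<open>q * \<theta>\<close>.\<close>

lemma kronecker_count:
  fixes p :: int and q K :: nat and \<theta> \<beta> t :: real
  assumes "coprime p (int q)" "q > 0" "\<bar>q * \<theta> - p\<bar> \<le> 1 / q" "0 \<le> t" "t \<le> 1"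
  shows "\<bar>(\<Sum>m<K. of_bool (frac (\<beta> + m * \<theta>) < t)) - K * t\<bar> \<le> 4 * (K / q) + q"
proof (induction K arbitrary: \<beta> rule: less_induct)
  case (less K)
  show ?case
  proof (cases "K < q")
    case True
    have "(\<Sum>m<K. of_bool (frac (\<beta> + m * \<theta>) < t)) \<le> (\<Sum>m<K. 1::real)"
      by (intro sum_mono) auto
    also have "\<dots> = K" by simp
    finally have "(\<Sum>m<K. (of_bool (frac (\<beta> + m * \<theta>) < t)::real)) \<le> K" .
    moreover have "(\<Sum>m<K. (of_bool (frac (\<beta> + m * \<theta>) < t)::real)) \<ge> 0"
      by (intro sum_nonneg) auto
    moreover have "0 \<le> K * t" "K * t \<le> K * 1"
      using assms by (auto intro: mult_left_le)
    moreover have "0 \<le> 4 * (real K / q)" by simp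
    moreover have "real K < real q" using True by simp
    ultimately show ?thesis unfolding abs_le_iff by linarith
  next
    case False
    define K' where "K' = K - q"
    have K: "K = q + K'" using False by (simp add: K'_def)
    have "(\<Sum>m<K. (of_bool (frac (\<beta> + m * \<theta>) < t)::real)) =
        (\<Sum>m<q. of_bool (frac (\<beta> + m * \<theta>) < t)) +
        (\<Sum>m<K'. of_bool (frac ((\<beta> + q * \<theta>) + m * \<theta>) < t))"
      unfolding K sum_lessThan_add by (simp add: algebra_simps)
    moreover have "\<bar>(\<Sum>m<K'. of_bool (frac ((\<beta> + q * \<theta>) + m * \<theta>) < t)) - K' * t\<bar> \<le> 4 * (K' / q) + q"
      by (rule less.IH) (use K assms in auto)
    moreover have "K * t = q * t + K' * t" "4 * (K / q) = 4 + 4 * (K' / q)"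
      using assms by (auto simp: K field_simps)
    ultimately show ?thesis
      using kronecker_block_count[OF assms, of \<beta>] by linarith
  qed
qed

section \<open>Lacunary tangent products\<close>

lemma sin_power2_mult:
  fixes x :: real
  shows "sin (2 ^ n * x) = 2 ^ n * sin x * (\<Prod>i<n. cos (2 ^ i * x))"
proof (induction n)
  case (Suc n)
  have "sin (2 ^ Suc n * x) = sin (2 * (2 ^ n * x))" by (simp add: mult.assoc)
  also have "\<dots> = 2 * sin (2 ^ n * x) * cos (2 ^ n * x)" by (rule sin_double)
  finally show ?case using Suc by simp
qed simp

text \<open>A doubling multiplies a tangent \<open>U\<close> in (0, 1) by
  \<open>2 / (1 - U ^ 2)\<close>, which is at least 2 and grows with \<open>U\<close>. Hence the
  ratio \<open>tan (2 ^ n * y) / tan y\<close> increases with \<open>y\<close>; it appears here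
  cross-multiplied.\<close>

lemma tan_power2_mono_ratio:
  fixes y z :: real
  assumes "0 < y" "y \<le> z" "2 ^ n * z < pi / 2"
  shows "tan (2 ^ n * y) * tan z \<le> tan (2 ^ n * z) * tan y \<and> 2 ^ n * tan y \<le> tan (2 ^ n * y)"
  using assms(3)
proof (induction n)
  case (Suc n)
  define u v where "u = 2 ^ n * y" and "v = 2 ^ n * z"
  have uv: "0 < u" "u \<le> v" "2 * v < pi / 2" using assms Suc.prems by (auto simp: u_def v_def)
  define U V where "U = tan u" and "V = tan v"
  have "U > 0" "U \<le> V" using uv unfolding U_def V_def
    by (auto intro!: tan_gt_zero tan_monotone' [THEN iffD1] simp: tan_mono_le_eq)
  moreover have "V < 1" using tan_monotone[of v "pi / 4"] uv by (simp add: V_def tan_45)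
  ultimately have UV: "0 < U" "U \<le> V" "V < 1" .
  have ty: "tan y > 0"
  proof (rule tan_gt_zero)
    have "1 * y \<le> 2 ^ n * y" using assms by (intro mult_right_mono) auto
    then show "y < pi / 2" using uv by (simp add: u_def)
  qed (use assms in auto)
  have "2 ^ n * z < pi / 2" using uv by (simp flip: v_def)
  then have IH: "U * tan z \<le> V * tan y" "2 ^ n * tan y \<le> U"
    using Suc.IH by (auto simp: U_def V_def u_def v_def)
  have dbl: "tan (2 * w) = 2 * tan w / (1 - tan w ^ 2)" if "0 < w" "w \<le> v" for w
    using that uv by (intro tan_double) (auto intro!: cos_gt_zero less_imp_neq[symmetric])
  have sq: "U ^ 2 \<le> V ^ 2" "V ^ 2 < 1" using UV by (auto intro!: power_mono simp: power_less_one_iff)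
  have "2 * U / (1 - U ^ 2) * tan z = 2 * (U * tan z) / (1 - U ^ 2)" by simp
  also have "\<dots> \<le> 2 * (V * tan y) / (1 - V ^ 2)"
    using IH sq UV ty by (intro frac_le) auto
  finally have "tan (2 * u) * tan z \<le> tan (2 * v) * tan y"
    using dbl[of u] dbl[of v] uv by (simp add: U_def V_def)
  moreover have "U ^ 2 < 1" using sq by linarith
  then have "2 * U / 1 \<le> 2 * U / (1 - U ^ 2)" using UV by (intro divide_left_mono) auto
  then have "2 * (2 ^ n * tan y) \<le> tan (2 * u)"
    using IH dbl[of u] uv by (simp add: U_def)
  ultimately show ?case by (simp add: u_def v_def mult.assoc)
qed (use assms in auto)

definition kappa :: "nat \<Rightarrow> real" where
  "kappa n = cot (pi / (2 * (2 ^ n + 1)))"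

text \<open>The angle solves \<open>2 ^ n * y = pi / 2 - y\<close>. For \<open>n \<ge> 1\<close>,
  multiplication by \<open>2 ^ n\<close> maps \<open>pi / 2 - y\<close> to its negative modulo
  \<open>pi\<close>, so at this point all factors of the tangent product have modulus
  \<open>kappa n\<close>.\<close>

lemma kappa_angle:
  fixes n :: nat
  defines "y \<equiv> pi / (2 * (2 ^ n + 1))"
  shows "0 < y" "2 ^ n * y = pi / 2 - y" "y < pi / 2"
    "tan (2 ^ n * y) = kappa n" "tan (y) = 1 / kappa n" "kappa n > 0"
proof -
  show 1: "0 < y" unfolding y_def by (intro divide_pos_pos) (auto simp: add_pos_pos)
  have "(2 ^ n + 1) * y = pi / 2"
    unfolding y_def by (simp add: field_simps add_pos_pos less_imp_neq[symmetric])
  then show 2: "2 ^ n * y = pi / 2 - y" by (simp add: algebra_simps)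
  have "0 < 2 ^ n * y" using 1 by simp
  then show 3: "y < pi / 2" using 2 by linarith
  show "tan (2 ^ n * y) = kappa n"
    unfolding 2 kappa_def y_def[symmetric] tan_cot by (simp add: cot_def tan_def)
  show "tan (y) = 1 / kappa n"
    unfolding kappa_def y_def[symmetric] by (simp add: cot_def tan_def)
  show "kappa n > 0"
    unfolding kappa_def y_def[symmetric] using 1 3 by (intro cot_gt_zero)
qed

text \<open>The second part of \<open>tan_power2_mono_ratio\<close> at the critical angle. It lets
  \<open>kappa n\<close> dominate a block whose sine is small, and it makes the final exponent at
  least 1/2.\<close>

lemma kappa_sq_ge: "2 ^ n \<le> kappa n ^ 2"
proof -
  define y where "y = pi / (2 * (2 ^ n + 1))"
  note k = kappa_angle[of n, folded y_def]
  have "2 ^ n * y < pi / 2" using k by linarith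
  then have "2 ^ n * tan y \<le> tan (2 ^ n * y)"
    using tan_power2_mono_ratio[OF k(1) order.refl] by blast
  then have "2 ^ n * (1 / kappa n) \<le> kappa n"
    unfolding k(4,5) .
  then show ?thesis using k(6) by (simp add: field_simps power2_eq_square)
qed

lemma kappa_ge_1: "1 \<le> kappa n"
proof -
  have "1 \<le> kappa n ^ 2" using kappa_sq_ge[of n] by (rule order.trans[rotated]) simp
  then show ?thesis using kappa_angle(6)[of n] by (simp add: power2_nonneg_ge_1_iff)
qed

text \<open>The modulus contributed by \<open>n\<close> consecutive digits, the first of them
  twisted by -1. For \<open>n \<ge> 1\<close> and \<open>cos x \<noteq> 0\<close> it is
  \<open>\<bar>sin (2 ^ n * x)\<bar> / \<bar>cos x\<bar>\<close>; the product form also covers the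
  zeros of the cosine.\<close>

definition block :: "nat \<Rightarrow> real \<Rightarrow> real" where
  "block n x = 2 * \<bar>sin x\<bar> * (\<Prod>i=1..<n. 2 * \<bar>cos (2 ^ i * x)\<bar>)"

lemma block_nonneg: "block n x \<ge> 0"
  unfolding block_def by (intro mult_nonneg_nonneg prod_nonneg) auto

text \<open>\<open>\<bar>cos x\<bar>\<close> supplies the index 0 that the block lacks and so
  completes the product in \<open>sin_power2_mult\<close>.\<close>

lemma block_times_cos:
  assumes "n \<ge> 1"
  shows "block n x * \<bar>cos x\<bar> = \<bar>sin (2 ^ n * x)\<bar>"
proof -
  have "{..<n} = insert 0 {1..<n}" using assms by auto
  then have "(\<Prod>i<n. \<bar>cos (2 ^ i * x)\<bar>) = \<bar>cos x\<bar> * (\<Prod>i=1..<n. \<bar>cos (2 ^ i * x)\<bar>)" by simp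
  moreover have "(2::real) ^ n = 2 * 2 ^ (n - 1)" using assms by (simp add: power_eq_if)
  ultimately show ?thesis
    unfolding block_def sin_power2_mult[of n x] by (simp add: prod.distrib abs_mult abs_prod)
qed

lemma block_le:
  assumes "n \<ge> 1"
  shows "block n x \<le> 2 ^ n"
proof -
  have "(\<Prod>i=1..<n. 2 * \<bar>cos (2 ^ i * x)\<bar>) \<le> (\<Prod>i=1..<n. 2)"
    by (intro prod_mono) auto
  then have "block n x \<le> (2 * 1) * (\<Prod>i=1..<n. 2)"
    unfolding block_def by (intro mult_mono prod_nonneg) auto
  then show ?thesis using assms by (simp add: power_eq_if)
qed

text \<open>This is the case \<open>\<bar>tan x\<bar> > kappa n\<close>. With \<open>y\<close> the
  distance to the nearest pole, two blocks together give \<open>tan (2 ^ n * y) / tan y\<close>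
  times the new sine. As \<open>y\<close> lies below the critical angle, monotonicity bounds this
  ratio by its value there, \<open>kappa n ^ 2\<close>.\<close>

lemma block_pair_bound:
  assumes n: "n \<ge> 1" and gt: "kappa n * \<bar>cos x\<bar> < \<bar>sin x\<bar>"
  shows "\<bar>sin x\<bar> * block n x * block n (2 ^ n * x) \<le> kappa n ^ 2 * \<bar>sin (2 ^ n * (2 ^ n * x))\<bar>"
proof -
  define y0 where "y0 = pi / (2 * (2 ^ n + 1))"
  note k = kappa_angle[of n, folded y0_def]
  \<comment> \<open>\<open>y \<in> [0, \<pi> / 2]\<close> is the distance of \<open>x\<close> from \<open>\<pi> / 2 + \<int>\<pi>\<close>.\<close>
  define y where "y = arccos (- cos (2 * x)) / 2"
  have y: "0 \<le> y" "y \<le> pi / 2"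
    using arccos_lbound[of "- cos (2 * x)"] arccos_ubound[of "- cos (2 * x)"] by (auto simp: y_def)
  have abs_eq_abs: "\<bar>u\<bar> = \<bar>v\<bar>" if "u ^ 2 = v ^ 2" for u v :: real
    using that by (metis real_sqrt_abs)
  have c2: "cos (2 * x) = - cos (2 * y)" by (simp add: y_def)
  have "cos x ^ 2 = sin y ^ 2" using c2 by (simp add: cos_double_cos cos_squared_eq)
  then have cx: "\<bar>cos x\<bar> = sin y" using y sin_ge_zero[of y] abs_eq_abs by simp
  have "sin x ^ 2 = cos y ^ 2" using \<open>cos x ^ 2 = sin y ^ 2\<close> by (simp add: cos_squared_eq)
  then have sx: "\<bar>sin x\<bar> = cos y" using y cos_ge_zero[of y] abs_eq_abs by simp
  \<comment> \<open>The exponents start at 1: at exponent 0 it is the sine of \<open>y\<close> that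
    matches the cosine of \<open>x\<close>. Squares discard the sign left by the first
    doubling.\<close>
  have cc: "cos (2 ^ Suc i * x) ^ 2 = cos (2 ^ Suc i * y) ^ 2" for i
  proof (induction i)
    case 0
    show ?case using c2 by simp
  next
    case (Suc i)
    have "cos (2 ^ Suc (Suc i) * w) = 2 * cos (2 ^ Suc i * w) ^ 2 - 1" for w :: real
      using cos_double_cos[of "2 ^ Suc i * w"] by (simp add: mult.assoc)
    then show ?case using Suc by simp
  qed
  have cn: "\<bar>cos (2 ^ n * x)\<bar> = \<bar>cos (2 ^ n * y)\<bar>"
    using cc[of "n - 1"] n by (intro abs_eq_abs) simp
  have sn: "\<bar>sin (2 ^ n * x)\<bar> = \<bar>sin (2 ^ n * y)\<bar>"
    using cc[of "n - 1"] n by (intro abs_eq_abs) (simp add: sin_squared_eq)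
  show ?thesis
  \<comment> \<open>At \<open>y = 0\<close> the quotients used below break down, but there
    \<open>sin (2 ^ n * x) = 0\<close> and the second block vanishes.\<close>
  proof (cases "y = 0")
    case True
    then show ?thesis using sn by (simp add: block_def)
  next
    case False
    then have y0: "0 < y" using y by simp
    have sy0: "sin y0 > 0" using k by (intro sin_gt_zero) auto
    have "kappa n = cos y0 / sin y0" by (simp only: kappa_def y0_def cot_def)
    then have "kappa n * sin y0 = cos y0" using sy0 by simp
    \<comment> \<open>The hypothesis means \<open>tan y < tan y0\<close>; in the form
      \<open>sin (y - y0) < 0\<close> it locates \<open>y\<close> without division.\<close>
    have "(kappa n * sin y) * sin y0 < cos y * sin y0"
      using gt sy0 unfolding cx sx by (intro mult_strict_right_mono)
    then have "sin (y - y0) < 0"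
      unfolding sin_diff \<open>kappa n * sin y0 = cos y0\<close>[symmetric] by (simp add: mult_ac)
    then have yy: "y < y0"
      using sin_ge_zero[of "y - y0"] y k by linarith
    have le: "2 ^ n * y0 < pi / 2" using k by linarith
    have "tan (2 ^ n * y) * tan y0 \<le> tan (2 ^ n * y0) * tan y"
      using tan_power2_mono_ratio[OF y0 _ le] yy by simp
    then have t: "tan (2 ^ n * y) \<le> kappa n ^ 2 * tan y"
      using k by (simp add: field_simps power2_eq_square)
    have "2 ^ n * y < 2 ^ n * y0" using yy by simp
    then have ny: "0 < 2 ^ n * y" "2 ^ n * y < pi / 2" using le y0 by (simp, linarith)
    have pos: "sin y > 0" "cos y > 0" "sin (2 ^ n * y) > 0" "cos (2 ^ n * y) > 0"
      using ny y0 yy k by (auto intro!: sin_gt_zero cos_gt_zero)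
    have b1: "block n x = sin (2 ^ n * y) / sin y"
      using block_times_cos[OF n, of x] pos unfolding cx sn by (simp add: field_simps)
    have b2: "block n (2 ^ n * x) = \<bar>sin (2 ^ n * (2 ^ n * x))\<bar> / cos (2 ^ n * y)"
      using block_times_cos[OF n, of "2 ^ n * x"] pos unfolding cn by (simp add: field_simps)
    have "\<bar>sin x\<bar> * block n x * block n (2 ^ n * x)
        = (tan (2 ^ n * y) / tan y) * \<bar>sin (2 ^ n * (2 ^ n * x))\<bar>"
      unfolding b1 b2 sx by (simp add: tan_def mult_ac)
    also have "\<dots> \<le> kappa n ^ 2 * \<bar>sin (2 ^ n * (2 ^ n * x))\<bar>"
      using t pos by (intro mult_right_mono) (auto simp: tan_def field_simps)
    finally show ?thesis .
  qed
qed

text \<open>The sine carried along telescopes: \<open>\<bar>sin x\<bar> * block n x\<close> is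
  \<open>\<bar>tan x\<bar>\<close> times the sine at \<open>2 ^ n * x\<close>. If the tangent is at
  most \<open>kappa n\<close>, one block is removed, otherwise two at once. The factor
  \<open>2 ^ n\<close> pays for a single last block and does not accumulate.\<close>

lemma sin_times_block_prod_bound:
  assumes n: "n \<ge> 1"
  shows "\<bar>sin x\<bar> * (\<Prod>j<L. block n (2 ^ (n * j) * x)) \<le> 2 ^ n * kappa n ^ L"
proof (induction L arbitrary: x rule: less_induct)
  case (less L)
  have step: "(\<Prod>j<Suc L'. block n (2 ^ (n * j) * z))
      = block n z * (\<Prod>j<L'. block n (2 ^ (n * j) * (2 ^ n * z)))" for L' z
    by (simp add: prod.lessThan_Suc_shift power_add mult_ac del: prod.lessThan_Suc)
  have pn: "(\<Prod>j<L'. block n (2 ^ (n * j) * z)) \<ge> 0" for L' z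
    by (intro prod_nonneg) (simp add: block_nonneg)
  consider "L = 0" | L' where "L = Suc L'" "\<bar>sin x\<bar> \<le> kappa n * \<bar>cos x\<bar>"
    | "L = 1" | L' where "L = Suc (Suc L')" "kappa n * \<bar>cos x\<bar> < \<bar>sin x\<bar>"
    by (metis One_nat_def not0_implies_Suc not_le)
  then show ?case
  proof cases
    case 1
    have "\<bar>sin x\<bar> \<le> 1" "(1::real) \<le> 2 ^ n" by auto
    then have "\<bar>sin x\<bar> \<le> 2 ^ n" by linarith
    then show ?thesis using 1 by simp
  next
    case 2
    have "\<bar>sin x\<bar> * block n x \<le> (kappa n * \<bar>cos x\<bar>) * block n x"
      using 2 block_nonneg by (intro mult_right_mono) auto
    also have "\<dots> = kappa n * \<bar>sin (2 ^ n * x)\<bar>" using block_times_cos[OF n, of x] by (simp add: mult_ac)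
    finally have "\<bar>sin x\<bar> * block n x * (\<Prod>j<L'. block n (2 ^ (n * j) * (2 ^ n * x)))
        \<le> kappa n * \<bar>sin (2 ^ n * x)\<bar> * (\<Prod>j<L'. block n (2 ^ (n * j) * (2 ^ n * x)))"
      using pn by (intro mult_right_mono)
    also have "\<dots> \<le> kappa n * (2 ^ n * kappa n ^ L')"
      using less.IH[of L' "2 ^ n * x"] 2 kappa_angle(6)[of n] by (simp add: mult.assoc)
    finally show ?thesis unfolding 2 step by (simp add: mult_ac)
  next
    case 3
    have "\<bar>sin x\<bar> * block n x \<le> 1 * 2 ^ n"
      using block_le[OF n] block_nonneg by (intro mult_mono) auto
    also have "\<dots> \<le> 2 ^ n * kappa n" using kappa_ge_1[of n] by simp
    finally show ?thesis using 3 by simp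
  next
    case 4
    let ?R = "\<Prod>j<L'. block n (2 ^ (n * j) * (2 ^ n * (2 ^ n * x)))"
    have "\<bar>sin x\<bar> * block n x * block n (2 ^ n * x) * ?R
        \<le> kappa n ^ 2 * \<bar>sin (2 ^ n * (2 ^ n * x))\<bar> * ?R"
      using pn by (intro mult_right_mono block_pair_bound n 4)
    also have "\<dots> \<le> kappa n ^ 2 * (2 ^ n * kappa n ^ L')"
      using less.IH[of L' "2 ^ n * (2 ^ n * x)"] 4 by (simp add: mult.assoc mult_left_mono)
    finally show ?thesis unfolding 4 step by (simp add: mult_ac power2_eq_square)
  qed
qed

text \<open>The sine is dropped at the cost of a factor 2 when it is at least 1/2. Otherwise
  \<open>cos x ^ 2 \<ge> 1 / 2\<close>, so the first block is at most
  \<open>sqrt 2 \<le> kappa n\<close> and the induction moves on to the next block.\<close>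

lemma block_prod_bound:
  assumes n: "n \<ge> 1"
  shows "(\<Prod>j<L. block n (2 ^ (n * j) * x)) \<le> 2 ^ (n + 1) * kappa n ^ L"
proof (induction L arbitrary: x)
  case (Suc L)
  let ?P = "\<lambda>L x. \<Prod>j<L. block n (2 ^ (n * j) * x)"
  have pn: "?P L z \<ge> 0" for L z
    by (intro prod_nonneg) (simp add: block_nonneg)
  show ?case
  proof (cases "\<bar>sin x\<bar> \<ge> 1 / 2")
    case True
    then have "1 / 2 * ?P (Suc L) x \<le> \<bar>sin x\<bar> * ?P (Suc L) x" using pn by (intro mult_right_mono)
    also have "\<dots> \<le> 2 ^ n * kappa n ^ Suc L" by (rule sin_times_block_prod_bound[OF n])
    finally show ?thesis by simp
  next
    case False
    then have "\<bar>sin x\<bar> ^ 2 \<le> (1 / 2) ^ 2" by (intro power_mono) auto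
    then have "sin x ^ 2 \<le> 1 / 4" by (simp add: power_divide)
    then have c: "cos x ^ 2 \<ge> 1 / 2" unfolding cos_squared_eq[of x] by linarith
    have "(block n x * \<bar>cos x\<bar>) ^ 2 \<le> 1"
      unfolding block_times_cos[OF n] by (simp add: abs_square_le_1)
    moreover have "block n x ^ 2 * (1 / 2) \<le> block n x ^ 2 * cos x ^ 2"
      using c by (intro mult_left_mono) auto
    ultimately have "block n x ^ 2 \<le> 2 ^ 1" by (simp add: power_mult_distrib)
    also have "(2::real) ^ 1 \<le> 2 ^ n" using n by (intro power_increasing) auto
    also have "\<dots> \<le> kappa n ^ 2" by (rule kappa_sq_ge)
    finally have bk: "block n x \<le> kappa n"
      using kappa_angle(6)[of n] by (simp add: power2_le_iff_abs_le block_nonneg)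
    have "?P (Suc L) x = block n x * ?P L (2 ^ n * x)"
      by (simp add: prod.lessThan_Suc_shift power_add mult_ac del: prod.lessThan_Suc)
    also have "\<dots> \<le> kappa n * (2 ^ (n + 1) * kappa n ^ L)"
      using bk Suc.IH[of "2 ^ n * x"] pn kappa_angle(6)[of n] by (intro mult_mono) auto
    finally show ?thesis by (simp add: mult_ac)
  qed
qed (use one_le_power[of "2::real" "n + 1"] in simp)

section \<open>Exponential sums with a digit character\<close>

text \<open>The weights are a parameter so that dropping low digits leads to a function of the same
  kind with shifted weights.\<close>

definition digit_character :: "(nat \<Rightarrow> real) \<Rightarrow> nat \<Rightarrow> real" where
  "digit_character \<epsilon> k = (\<Prod>j\<in>{j. binary_digit k j \<noteq> 0}. \<epsilon> j)"

lemma binary_digit_Suc: "binary_digit k (Suc j) = binary_digit (k div 2) j"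
  by (simp add: binary_digit_def div_mult2_eq)

lemma binary_digit_0: "binary_digit k 0 = k mod 2"
  by (simp add: binary_digit_def)

lemma binary_digit_eq_0: "k < 2 ^ j \<Longrightarrow> binary_digit k j = 0"
  by (simp add: binary_digit_def)

lemma finite_binary_digits: "finite {j. binary_digit k j \<noteq> 0}"
proof (rule finite_subset)
  show "{j. binary_digit k j \<noteq> 0} \<subseteq> {..<k}"
  proof
    fix j assume "j \<in> {j. binary_digit k j \<noteq> 0}"
    then have "2 ^ j \<le> k" using binary_digit_eq_0[of k j] by (simp add: not_less[symmetric]) blast
    moreover have "j < 2 ^ j" by (rule less_exp)
    ultimately have "j < k" by linarith
    then show "j \<in> {..<k}" by simp
  qed
qed simp

lemma digit_support_rec:
  "{j. binary_digit k j \<noteq> 0} = (if odd k then {0} else {}) \<union> Suc ` {j. binary_digit (k div 2) j \<noteq> 0}"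
  (is "?A = ?B")
proof (rule set_eqI)
  fix j show "j \<in> ?A \<longleftrightarrow> j \<in> ?B"
    by (cases j) (auto simp: binary_digit_Suc binary_digit_0 odd_iff_mod_2_eq_one even_iff_mod_2_eq_zero)
qed

lemma digit_character_rec:
  "digit_character \<epsilon> k = (if odd k then \<epsilon> 0 else 1) * digit_character (\<lambda>j. \<epsilon> (Suc j)) (k div 2)"
  unfolding digit_character_def digit_support_rec[of k]
  by (subst prod.union_disjoint) (auto simp: finite_binary_digits[simplified] prod.reindex)

text \<open>Needed along residue classes modulo \<open>2 ^ l\<close>, where only the high digits
  vary and the low ones contribute a constant.\<close>

lemma digit_character_shift:
  assumes "\<rho> < 2 ^ l"
  shows "digit_character \<epsilon> (\<rho> + 2 ^ l * m) = digit_character \<epsilon> \<rho> * digit_character (\<lambda>j. \<epsilon> (l + j)) m"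
  using assms
proof (induction l arbitrary: \<rho> \<epsilon>)
  case 0
  then show ?case by (simp add: digit_character_def binary_digit_def)
next
  case (Suc l)
  have "(\<rho> + 2 ^ Suc l * m) div 2 = \<rho> div 2 + 2 ^ l * m" by simp
  moreover have "\<rho> div 2 < 2 ^ l" using Suc.prems by auto
  ultimately show ?case
    using Suc.IH[of "\<rho> div 2" "\<lambda>j. \<epsilon> (Suc j)"]
    by (subst (1 2) digit_character_rec) simp
qed

lemma abs_digit_character_le:
  assumes "\<And>j. \<bar>\<epsilon> j\<bar> \<le> 1"
  shows "\<bar>digit_character \<epsilon> k\<bar> \<le> 1"
  unfolding digit_character_def abs_prod using assms by (intro prod_le_1) auto

text \<open>The 2 in the exponent is chosen so that \<open>1 + cis (2 * x)\<close> and
  \<open>1 - cis (2 * x)\<close> have moduli \<open>2 * \<bar>cos x\<bar>\<close> and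
  \<open>2 * \<bar>sin x\<bar>\<close>.\<close>

definition digit_exp_sum :: "(nat \<Rightarrow> real) \<Rightarrow> nat \<Rightarrow> real \<Rightarrow> complex" where
  "digit_exp_sum \<epsilon> M x = (\<Sum>m<M. of_real (digit_character \<epsilon> m) * cis (2 * m * x))"

lemma sum_lessThan_double:
  fixes f :: "nat \<Rightarrow> 'a::comm_monoid_add"
  shows "(\<Sum>m<2 * M. f m) = (\<Sum>m<M. f (2 * m) + f (2 * m + 1))"
  by (induction M) (simp_all add: add.assoc)

text \<open>Pairing \<open>2 * m\<close> with \<open>2 * m + 1\<close> extracts the factor of the
  lowest digit and leaves a sum of half the length at the doubled angle. An odd \<open>M\<close>
  leaves one term of modulus at most 1; these leftovers produce the sum of partial products.\<close>

lemma digit_exp_sum_bound: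
  assumes "\<And>j. \<bar>\<epsilon> j\<bar> \<le> 1" "M < 2 ^ L"
  shows "cmod (digit_exp_sum \<epsilon> M x)
           \<le> (\<Sum>i<L. \<Prod>j<i. cmod (1 + of_real (\<epsilon> j) * cis (2 * (2 ^ j * x))))"
  using assms
proof (induction L arbitrary: \<epsilon> M x)
  case (Suc L)
  define \<epsilon>' where "\<epsilon>' = (\<lambda>j. \<epsilon> (Suc j))"
  define M' where "M' = M div 2"
  define c where "c = 1 + of_real (\<epsilon> 0) * cis (2 * x)"
  let ?f = "\<lambda>m. of_real (digit_character \<epsilon> m) * cis (2 * real m * x)"
  have "?f (2 * m) + ?f (2 * m + 1) =
      c * (of_real (digit_character \<epsilon>' m) * cis (2 * real m * (2 * x)))" for m
    by (subst (1 2) digit_character_rec)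
       (simp add: \<epsilon>'_def c_def algebra_simps cis_mult)
  then have even: "(\<Sum>m<2 * M'. ?f m) = c * digit_exp_sum \<epsilon>' M' (2 * x)"
    unfolding sum_lessThan_double digit_exp_sum_def sum_distrib_left by simp
  have IH: "cmod (digit_exp_sum \<epsilon>' M' (2 * x))
      \<le> (\<Sum>i<L. \<Prod>j<i. cmod (1 + of_real (\<epsilon>' j) * cis (2 * (2 ^ j * (2 * x)))))"
    using Suc.prems by (intro Suc.IH) (auto simp: \<epsilon>'_def M'_def)
  have "cmod (?f m) \<le> 1" for m
    using abs_digit_character_le[OF Suc.prems(1)] by (simp add: norm_mult)
  note f1 = this
  have "cmod (digit_exp_sum \<epsilon> M x) \<le> cmod (\<Sum>m<2 * M'. ?f m) + 1"
  proof (cases "odd M")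
    case True
    then have "M = Suc (2 * M')" by (simp add: M'_def)
    then have "digit_exp_sum \<epsilon> M x = (\<Sum>m<2 * M'. ?f m) + ?f (2 * M')"
      by (simp add: digit_exp_sum_def)
    then show ?thesis
      by (metis (no_types, lifting) f1 norm_triangle_ineq add_left_mono order.trans)
  next
    case False
    then have "M = 2 * M'" by (simp add: M'_def)
    then have "digit_exp_sum \<epsilon> M x = (\<Sum>m<2 * M'. ?f m)"
      by (simp add: digit_exp_sum_def)
    then show ?thesis by simp
  qed
  also have "\<dots> \<le> cmod c * (\<Sum>i<L. \<Prod>j<i. cmod (1 + of_real (\<epsilon>' j) * cis (2 * (2 ^ j * (2 * x))))) + 1"
    unfolding even norm_mult by (intro add_right_mono mult_left_mono IH) auto
  \<comment> \<open>The added 1 is the empty product at \<open>i = 0\<close>.\<close>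
  also have "\<dots> = (\<Sum>i<Suc L. \<Prod>j<i. cmod (1 + of_real (\<epsilon> j) * cis (2 * (2 ^ j * x))))"
    unfolding sum.lessThan_Suc_shift sum_distrib_left prod.lessThan_Suc_shift
    by (simp add: c_def \<epsilon>'_def mult_ac del: sum.lessThan_Suc prod.lessThan_Suc)
  finally show ?case .
qed (simp add: digit_exp_sum_def)

lemma cmod_one_plus_cis: "cmod (1 + cis (2 * x)) = 2 * \<bar>cos x\<bar>"
proof -
  have "1 + cis (2 * x) = cis x * of_real (2 * cos x)"
    by (rule complex_eqI) (simp_all add: cos_double_cos sin_double power2_eq_square)
  then show ?thesis by (simp add: norm_mult)
qed

lemma cmod_one_minus_cis: "cmod (1 - cis (2 * x)) = 2 * \<bar>sin x\<bar>"
proof -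
  have "1 - cis (2 * x) = cis x * (- \<i> * of_real (2 * sin x))"
    by (rule complex_eqI) (simp_all add: cos_double_sin sin_double power2_eq_square)
  then show ?thesis by (simp add: norm_mult)
qed

section \<open>Products for the signs of the perturbed row\<close>

definition row_sign :: "nat \<Rightarrow> nat \<Rightarrow> real" where
  "row_sign n j = (if n dvd j then -1 else 1)"

lemma abs_row_sign: "\<bar>row_sign n j\<bar> = 1"
  by (simp add: row_sign_def)

lemma prod_lessThan_add:
  fixes f :: "nat \<Rightarrow> 'a::comm_monoid_mult"
  shows "(\<Prod>m<a + b. f m) = (\<Prod>m<a. f m) * (\<Prod>m<b. f (a + m))"
  by (induction b) (simp_all add: mult.assoc)

definition row_factor :: "nat \<Rightarrow> nat \<Rightarrow> real \<Rightarrow> real" where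
  "row_factor n j y = cmod (1 + of_real (row_sign n j) * cis (2 * y))"

lemma row_factor_nonneg: "0 \<le> row_factor n j y"
  by (simp add: row_factor_def)

lemma row_factor_eq: "row_factor n j y = (if n dvd j then 2 * \<bar>sin y\<bar> else 2 * \<bar>cos y\<bar>)"
  using cmod_one_plus_cis[of y] cmod_one_minus_cis[of y] by (simp add: row_factor_def row_sign_def)

lemma row_factor_le: "row_factor n j y \<le> 2"
  by (simp add: row_factor_eq)

lemma prod_row_factor_le: "(\<Prod>j<i. row_factor n (l + j) (f j)) \<le> 2 ^ i"
proof -
  have "(\<Prod>j<i. row_factor n (l + j) (f j)) \<le> (\<Prod>j<i. 2)"
    by (intro prod_mono) (auto simp: row_factor_nonneg row_factor_le)
  then show ?thesis by simp
qed

text \<open>Among \<open>n\<close> consecutive indices starting at a multiple of \<open>n\<close>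
  only the first gives a sine, which is the shape of a block; hence the alignment of
  \<open>l\<close>.\<close>

lemma prod_row_factor_blocks:
  assumes "n \<ge> 1" "n dvd l"
  shows "(\<Prod>j<n * L. row_factor n (l + j) (2 ^ j * x)) = (\<Prod>j<L. block n (2 ^ (n * j) * x))"
proof (induction L)
  case (Suc L)
  have "(\<Prod>m<n. row_factor n (l + (n * L + m)) (2 ^ (n * L + m) * x)) = block n (2 ^ (n * L) * x)"
  proof -
    have "{..<n} = insert 0 {1..<n}" using assms by auto
    then have "(\<Prod>m<n. row_factor n (l + (n * L + m)) (2 ^ (n * L + m) * x)) =
        row_factor n (l + n * L) (2 ^ (n * L) * x) *
        (\<Prod>m=1..<n. row_factor n (l + (n * L + m)) (2 ^ (n * L + m) * x))" by simp
    also have "row_factor n (l + n * L) (2 ^ (n * L) * x) = 2 * \<bar>sin (2 ^ (n * L) * x)\<bar>"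
      using assms by (simp add: row_factor_eq)
    also have "(\<Prod>m=1..<n. row_factor n (l + (n * L + m)) (2 ^ (n * L + m) * x)) =
       (\<Prod>m=1..<n. 2 * \<bar>cos (2 ^ m * (2 ^ (n * L) * x))\<bar>)"
    proof (intro prod.cong refl)
      fix m assume "m \<in> {1..<n}"
      then have "\<not> n dvd m" by (auto dest: dvd_imp_le)
      then have "\<not> n dvd l + (n * L + m)" using assms by (simp add: dvd_add_right_iff)
      then show "row_factor n (l + (n * L + m)) (2 ^ (n * L + m) * x) = 2 * \<bar>cos (2 ^ m * (2 ^ (n * L) * x))\<bar>"
        by (simp add: row_factor_eq power_add mult_ac)
    qed
    finally show ?thesis unfolding block_def .
  qed
  then show ?case using Suc by (simp add: prod_lessThan_add add.commute[of n])
qed simp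

text \<open>For arbitrary \<open>l\<close> the product is cut into a head up to the next multiple of
  \<open>n\<close>, full blocks, and a tail. Head and tail have fewer than \<open>n\<close> factors,
  each at most 2, which gives \<open>2 ^ n * 2 ^ (n + 1) * 2 ^ n\<close>.\<close>

lemma prod_row_factor_bound:
  assumes n: "n \<ge> 1"
  shows "(\<Prod>j<i. row_factor n (l + j) (2 ^ j * x)) \<le> 2 ^ (3 * n + 1) * kappa n ^ (i div n)"
proof -
  \<comment> \<open>The outer \<open>mod\<close> makes the head empty when \<open>n\<close> already
    divides \<open>l\<close>.\<close>
  define j0 where "j0 = (n - l mod n) mod n"
  have j0: "j0 < n" "n dvd l + j0"
  proof -
    show "j0 < n" using n by (simp add: j0_def)
    have "(l + j0) mod n = (l mod n + (n - l mod n)) mod n" unfolding j0_def by presburger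
    also have "\<dots> = 0" using n by (simp add: mod_le_divisor less_imp_le)
    finally show "n dvd l + j0" by auto
  qed
  have pn: "0 \<le> (\<Prod>j<k. row_factor n (m + j) (f j))" for k m f
    by (intro prod_nonneg) (simp add: row_factor_nonneg)
  have k1: "1 \<le> kappa n ^ k" for k using kappa_ge_1 by (rule one_le_power)
  show ?thesis
  proof (cases "i \<le> j0")
    case True
    have "(\<Prod>j<i. row_factor n (l + j) (2 ^ j * x)) \<le> 2 ^ i" by (rule prod_row_factor_le)
    also have "(2::real) ^ i \<le> 2 ^ (3 * n + 1)" using True j0 by (intro power_increasing) auto
    also have "\<dots> \<le> 2 ^ (3 * n + 1) * kappa n ^ (i div n)" using k1[of "i div n"] by simp
    finally show ?thesis .
  next
    case False
    define L where "L = (i - j0) div n"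
    define r where "r = (i - j0) mod n"
    have i: "i = j0 + (n * L + r)" using False by (simp add: L_def r_def)
    have r: "r < n" using n by (simp add: r_def)
    have L: "L \<le> i div n" unfolding L_def by (intro div_le_mono) simp
    define A where "A = (\<Prod>j<j0. row_factor n (l + j) (2 ^ j * x))"
    define B where "B = (\<Prod>j<n * L. row_factor n ((l + j0) + j) (2 ^ j * (2 ^ j0 * x)))"
    define C where "C = (\<Prod>j<r. row_factor n ((l + j0 + n * L) + j) (2 ^ j * (2 ^ (n * L) * (2 ^ j0 * x))))"
    have "(\<Prod>j<i. row_factor n (l + j) (2 ^ j * x)) = A * (B * C)"
      unfolding i prod_lessThan_add A_def B_def C_def by (simp add: power_add add_ac mult_ac)
    also have "\<dots> \<le> 2 ^ n * ((2 ^ (n + 1) * kappa n ^ L) * 2 ^ n)"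
    proof (intro mult_mono)
      have "A \<le> 2 ^ j0" unfolding A_def by (rule prod_row_factor_le)
      also have "\<dots> \<le> 2 ^ n" using j0 by (intro power_increasing) auto
      finally show "A \<le> 2 ^ n" .
      have "C \<le> 2 ^ r" unfolding C_def by (rule prod_row_factor_le)
      also have "\<dots> \<le> 2 ^ n" using r by (intro power_increasing) auto
      finally show "C \<le> 2 ^ n" .
      show "B \<le> 2 ^ (n + 1) * kappa n ^ L"
        unfolding B_def prod_row_factor_blocks[OF n j0(2)] by (rule block_prod_bound[OF n])
      show "0 \<le> C" "0 \<le> B * C" unfolding B_def C_def by (intro mult_nonneg_nonneg pn)+
    qed (use k1[of L] in auto)
    also have "\<dots> = 2 ^ (3 * n + 1) * kappa n ^ L" by (simp add: power_add power_mult eval_nat_numeral)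
    also have "\<dots> \<le> 2 ^ (3 * n + 1) * kappa n ^ (i div n)"
      using L kappa_ge_1 by (intro mult_left_mono power_increasing) auto
    finally show ?thesis .
  qed
qed

text \<open>Uniformity in \<open>x\<close> and \<open>l\<close> is essential: \<open>x\<close> will
  run over all Fourier frequencies and \<open>l\<close> over all dyadic levels.\<close>

lemma row_exp_sum_bound:
  assumes n: "n \<ge> 1" and M: "M < 2 ^ L"
  shows "cmod (digit_exp_sum (\<lambda>j. row_sign n (l + j)) M x) \<le> L * (2 ^ (3 * n + 1) * kappa n ^ (L div n))"
proof -
  have "cmod (digit_exp_sum (\<lambda>j. row_sign n (l + j)) M x)
      \<le> (\<Sum>i<L. \<Prod>j<i. row_factor n (l + j) (2 ^ j * x))"
    unfolding row_factor_def by (rule digit_exp_sum_bound) (simp_all add: abs_row_sign M)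
  also have "\<dots> \<le> (\<Sum>i<L. 2 ^ (3 * n + 1) * kappa n ^ (L div n))"
  proof (intro sum_mono)
    fix i assume "i \<in> {..<L}"
    then have "i div n \<le> L div n" by (intro div_le_mono) simp
    then have "2 ^ (3 * n + 1) * kappa n ^ (i div n) \<le> 2 ^ (3 * n + 1) * kappa n ^ (L div n)"
      using kappa_ge_1 by (intro mult_left_mono power_increasing) auto
    then show "(\<Prod>j<i. row_factor n (l + j) (2 ^ j * x)) \<le> 2 ^ (3 * n + 1) * kappa n ^ (L div n)"
      using prod_row_factor_bound[OF n, where i = i and l = l and x = x] by linarith
  qed
  also have "\<dots> = L * (2 ^ (3 * n + 1) * kappa n ^ (L div n))" by simp
  finally show ?thesis .
qed

section \<open>Finite Fourier expansion of interval indicators\<close>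

text \<open>\<open>sin y \<ge> y - y ^ 3 / 6\<close> together with \<open>y ^ 2 \<le> 4\<close>. The
  constant 1/3 will cancel against \<open>pi > 3\<close>.\<close>

lemma sin_ge_third:
  fixes y :: real
  assumes "0 \<le> y" "y \<le> pi / 2"
  shows "y / 3 \<le> sin y"
proof -
  have "\<bar>sin y - (\<Sum>m<3. sin_coeff m * y ^ m)\<bar> \<le> inverse (fact 3) * \<bar>y\<bar> ^ 3"
    by (rule Maclaurin_sin_bound)
  also have "(\<Sum>m<3. sin_coeff m * y ^ m) = y"
    by (simp add: eval_nat_numeral sin_coeff_def)
  finally have "\<bar>sin y - y\<bar> \<le> y ^ 3 / 6" using assms by (simp add: fact_numeral)
  then have "sin y \<ge> y - y ^ 3 / 6" by linarith
  moreover have "y * y ^ 2 \<le> y * 2 ^ 2"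
    using assms pi_less_4 by (intro mult_left_mono power_mono) auto
  then have "y ^ 3 \<le> 4 * y" by (simp add: eval_nat_numeral)
  ultimately show ?thesis by linarith
qed

text \<open>For \<open>2 * k \<le> Q\<close> one has \<open>sin (pi * k / Q) \<ge> k / Q\<close>,
  and the reflection \<open>h \<mapsto> Q - h\<close> reaches the other half. Adding both
  reciprocals avoids a case distinction in the summation.\<close>

lemma inverse_sin_le:
  assumes "0 < h" "h < Q"
  shows "1 / sin (pi * h / Q) \<le> Q * (1 / real h + 1 / real (Q - h))"
proof -
  have *: "1 / sin (pi * k / Q) \<le> Q / real k" if "0 < k" "2 * k \<le> Q" for k :: nat
  proof -
    have "k / Q \<le> 1 / 2" using that by (simp add: field_simps)
    then have "pi * (k / Q) \<le> pi * (1 / 2)" by (intro mult_left_mono) auto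
    then have "(pi * k / Q) / 3 \<le> sin (pi * k / Q)"
      using that by (intro sin_ge_third) auto
    moreover have "3 * k / Q / 3 \<le> (pi * k / Q) / 3"
      using pi_gt3 that by (intro divide_right_mono mult_right_mono) auto
    ultimately have "real k / Q \<le> sin (pi * k / Q)" by simp
    then have "1 / sin (pi * k / Q) \<le> 1 / (real k / Q)"
      using that by (intro divide_left_mono) (auto intro!: mult_pos_pos divide_pos_pos elim: less_le_trans[rotated])
    then show ?thesis by simp
  qed
  show ?thesis
  proof (cases "2 * h \<le> Q")
    case True
    then have "1 / sin (pi * h / Q) \<le> Q * (1 / real h)" using *[of h] assms by simp
    also have "\<dots> \<le> Q * (1 / real h + 1 / real (Q - h))" by (intro mult_left_mono) auto
    finally show ?thesis .
  next
    case False
    have "pi * h / Q = pi - pi * real (Q - h) / Q" using assms by (simp add: field_simps of_nat_diff)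
    then have "1 / sin (pi * h / Q) = 1 / sin (pi * real (Q - h) / Q)" by simp
    also have "\<dots> \<le> Q * (1 / real (Q - h))" using *[of "Q - h"] assms False by simp
    also have "\<dots> \<le> Q * (1 / real h + 1 / real (Q - h))" by (intro mult_left_mono) auto
    finally show ?thesis .
  qed
qed

lemma cis_geometric_sum_bound:
  assumes "sin y \<noteq> 0"
  shows "cmod (\<Sum>u<T. cis (2 * real u * y)) \<le> 1 / \<bar>sin y\<bar>"
proof -
  define z where "z = cis (2 * y)"
  have z: "cis (2 * real u * y) = z ^ u" for u :: nat
    unfolding z_def Complex.DeMoivre by (simp add: mult_ac)
  have ne: "cmod (1 - z) = 2 * \<bar>sin y\<bar>" unfolding z_def by (rule cmod_one_minus_cis)
  have "(1 - z) * (\<Sum>u<T. z ^ u) = 1 - z ^ T" by (rule one_diff_power_eq[symmetric])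
  then have "cmod (1 - z) * cmod (\<Sum>u<T. z ^ u) = cmod (1 - z ^ T)" by (metis norm_mult)
  also have "\<dots> \<le> 1 + 1"
    using norm_triangle_ineq4[of 1 "z ^ T"] by (simp add: z_def norm_power)
  finally show ?thesis using assms unfolding ne z by (simp add: field_simps)
qed

lemma harm_le:
  assumes "n \<ge> 1"
  shows "(\<Sum>h=1..n. 1 / real h) \<le> 1 + ln (real n)"
proof -
  have "harm n - ln (real n) \<le> harm 1 - ln (real 1)"
    by (rule euler_mascheroni_sequence_decreasing) (use assms in auto)
  then show ?thesis by (simp add: harm_def inverse_eq_divide)
qed

text \<open>The summands are moduli of unnormalised Fourier coefficients of \<open>T\<close>
  consecutive residues modulo \<open>Q\<close>. Frequency 0 contributes \<open>T\<close>, the others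
  at most \<open>2 * Q\<close> times a harmonic sum.\<close>

lemma lebesgue_constant_bound:
  fixes T Q :: nat
  assumes "T \<le> Q" "Q \<ge> 1"
  shows "(\<Sum>h<Q. cmod (\<Sum>u<T. cis (2 * real u * (pi * h / Q)))) \<le> Q * (3 + 2 * ln Q)"
proof -
  have split: "{..<Q} = insert 0 {1..<Q}" using assms by auto
  have "(\<Sum>h=1..<Q. cmod (\<Sum>u<T. cis (2 * real u * (pi * h / Q))))
     \<le> (\<Sum>h=1..<Q. Q * (1 / real h + 1 / real (Q - h)))"
  proof (intro sum_mono)
    fix h assume "h \<in> {1..<Q}"
    then have h: "0 < h" "h < Q" by auto
    then have "pi * h / Q < pi" by (simp add: field_simps)
    then have "sin (pi * h / Q) > 0" using h by (intro sin_gt_zero) auto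
    then show "cmod (\<Sum>u<T. cis (2 * real u * (pi * h / Q))) \<le> Q * (1 / real h + 1 / real (Q - h))"
      using cis_geometric_sum_bound[of "pi * h / Q" T] inverse_sin_le[OF h] by simp
  qed
  also have "\<dots> = Q * ((\<Sum>h=1..<Q. 1 / real h) + (\<Sum>h=1..<Q. 1 / real (Q - h)))"
    by (simp add: sum_distrib_left sum.distrib ring_distribs)
  also have "(\<Sum>h=1..<Q. 1 / real (Q - h)) = (\<Sum>h=1..<Q. 1 / real h)"
    by (rule sum.reindex_bij_witness[of _ "\<lambda>h. Q - h" "\<lambda>h. Q - h"]) auto
  also have "(\<Sum>h=1..<Q. 1 / real h) + (\<Sum>h=1..<Q. 1 / real h) \<le> 2 + 2 * ln Q"
  proof -
    have "(\<Sum>h=1..<Q. 1 / real h) \<le> (\<Sum>h=1..Q. 1 / real h)" by (intro sum_mono2) auto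
    then show ?thesis using harm_le[OF assms(2)] by linarith
  qed
  finally have "(\<Sum>h=1..<Q. cmod (\<Sum>u<T. cis (2 * real u * (pi * h / Q)))) \<le> Q * (2 + 2 * ln Q)"
    by (simp add: mult_left_mono)
  moreover have "(\<Sum>h<Q. cmod (\<Sum>u<T. cis (2 * real u * (pi * h / Q))))
      = T + (\<Sum>h=1..<Q. cmod (\<Sum>u<T. cis (2 * real u * (pi * h / Q))))"
    unfolding split by simp
  ultimately show ?thesis using assms by (simp add: algebra_simps)
qed

text \<open>Orthogonality of the additive characters modulo \<open>Q\<close>.\<close>

lemma sum_cis_multiples:
  fixes d :: int and Q :: nat
  assumes "Q \<ge> 1"
  shows "(\<Sum>h<Q. cis (2 * (pi * h / Q) * d)) = (if int Q dvd d then of_nat Q else 0)"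
proof -
  define z where "z = cis (2 * (pi * d / Q))"
  have z: "cis (2 * (pi * h / Q) * d) = z ^ h" for h :: nat
    unfolding z_def Complex.DeMoivre by (simp add: mult_ac)
  show ?thesis
  proof (cases "int Q dvd d")
    case True
    then obtain e where "d = int Q * e" by blast
    then have "z = cis (2 * pi * e)" using assms by (simp add: z_def mult_ac)
    then have "z = 1" by (simp add: cis_multiple_2pi)
    then show ?thesis unfolding z using True by simp
  next
    case False
    have "z \<noteq> 1"
    proof
      assume "z = 1"
      then have "sin (pi * d / Q) = 0"
        using cmod_one_minus_cis[of "pi * d / Q"] by (simp add: z_def)
      then obtain e :: int where "pi * d / Q = e * pi" by (auto simp: sin_zero_iff_int2)
      then have "real_of_int d = of_int (e * int Q)" using assms by (simp add: field_simps)
      then have "d = e * int Q" by linarith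
      then show False using False by simp
    qed
    moreover have "z ^ Q = 1"
    proof -
      have "z ^ Q = cis (real Q * (2 * (pi * d / Q)))" unfolding z_def by (rule Complex.DeMoivre)
      also have "real Q * (2 * (pi * d / Q)) = 2 * pi * d" using assms by simp
      also have "cis (2 * pi * d) = 1" by (rule cis_multiple_2pi) simp
      finally show ?thesis .
    qed
    ultimately show ?thesis unfolding z using False by (simp add: geometric_sum)
  qed
qed

text \<open>Fourier inversion on the residues modulo \<open>Q\<close>. The expansion is finite and
  exact, so no truncation error has to be controlled.\<close>

lemma of_bool_mod_less_fourier:
  fixes j :: int and Q T :: nat
  assumes "T \<le> Q" "Q \<ge> 1"
  shows "of_bool (j mod int Q < int T)
    = (\<Sum>h<Q. cnj (\<Sum>u<T. cis (2 * real u * (pi * h / Q))) * cis (2 * j * (pi * h / Q))) / of_nat Q"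
proof -
  have "(\<Sum>h<Q. cnj (\<Sum>u<T. cis (2 * real u * (pi * h / Q))) * cis (2 * j * (pi * h / Q)))
    = (\<Sum>h<Q. \<Sum>u<T. cis (2 * (pi * h / Q) * (j - int u)))"
    unfolding cnj_sum sum_distrib_right
    by (intro sum.cong refl) (simp add: cis_cnj cis_mult algebra_simps diff_divide_distrib)
  also have "\<dots> = (\<Sum>u<T. if int Q dvd (j - int u) then of_nat Q else 0)"
    by (subst sum.swap) (simp only: sum_cis_multiples[OF assms(2)])
  also have "\<dots> = (\<Sum>u<T. if u = nat (j mod int Q) then of_nat Q else 0)"
  proof (intro sum.cong refl)
    fix u assume "u \<in> {..<T}"
    then have "int u mod int Q = int u" using assms by simp
    then have "int Q dvd (j - int u) \<longleftrightarrow> j mod int Q = int u"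
      by (metis mod_eq_dvd_iff)
    also have "\<dots> \<longleftrightarrow> u = nat (j mod int Q)" using assms by auto
    finally show "(if int Q dvd (j - int u) then of_nat Q else 0) =
       (if u = nat (j mod int Q) then of_nat Q else (0::complex))" by simp
  qed
  also have "\<dots> = of_nat Q * of_bool (j mod int Q < int T)"
    using assms by (auto simp: nat_less_iff)
  finally show ?thesis using assms by simp
qed

text \<open>On multiples of \<open>1 / Q\<close> a real threshold acts like an integer one, so the
  interval becomes a run of residues.\<close>

lemma frac_rational_less_iff:
  fixes j :: int and Q :: nat and t :: real
  assumes "0 \<le> t" "t \<le> 1" "Q \<ge> 1"
  shows "frac (j / Q) < t \<longleftrightarrow> j mod int Q < int (nat \<lceil>t * Q\<rceil>)"
proof -
  have fr: "frac (j / Q) = (j mod int Q) / Q"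
  proof -
    have "\<lfloor>j / Q\<rfloor> = j div int Q" using floor_divide_of_int_eq[of j "int Q"] by simp
    moreover have "real_of_int j = of_int (int Q * (j div int Q) + j mod int Q)" by simp
    then have "real_of_int j = real Q * real_of_int (j div int Q) + real_of_int (j mod int Q)"
      unfolding of_int_add of_int_mult by simp
    ultimately show ?thesis using assms by (simp add: frac_def field_simps)
  qed
  have "frac (j / Q) < t \<longleftrightarrow> of_int (j mod int Q) < t * Q"
    unfolding fr using assms by (simp add: divide_less_eq)
  also have "\<dots> \<longleftrightarrow> j mod int Q < \<lceil>t * Q\<rceil>" by (rule less_ceiling_iff[symmetric])
  finally show ?thesis using mult_nonneg_nonneg[OF assms(1), of "real Q"] by simp
qed

text \<open>After exchanging the sums, each inner exponential sum is at most \<open>B\<close>, and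
  the \<open>1 / Q\<close> of the Fourier inversion cancels the \<open>Q\<close> of
  \<open>lebesgue_constant_bound\<close>.\<close>

lemma weighted_count_rational_bound:
  fixes w :: "nat \<Rightarrow> real" and j :: "nat \<Rightarrow> int" and Q :: nat and t :: real
  assumes "0 \<le> t" "t \<le> 1" "Q \<ge> 1"
    and B: "\<And>y::real. cmod (\<Sum>m<K. of_real (w m) * cis (2 * real_of_int (j m) * y)) \<le> B"
  shows "\<bar>\<Sum>m<K. w m * of_bool (frac (j m / Q) < t)\<bar> \<le> B * (3 + 2 * ln Q)"
proof -
  define T where "T = nat \<lceil>t * Q\<rceil>"
  have "t * Q \<le> Q" using assms by (simp add: mult_left_le_one_le)
  then have T: "T \<le> Q" by (simp add: T_def ceiling_le_iff)
  define a where "a h = (\<Sum>u<T. cis (2 * real u * (pi * h / Q)))" for h :: nat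
  have "complex_of_real (\<Sum>m<K. w m * of_bool (frac (j m / Q) < t))
     = (\<Sum>m<K. of_real (w m) * of_bool (j m mod int Q < int T))"
    unfolding frac_rational_less_iff[OF assms(1-3)] T_def by simp
  also have "\<dots> = (\<Sum>m<K. \<Sum>h<Q. cnj (a h) * (of_real (w m) * cis (2 * j m * (pi * h / Q)))) / of_nat Q"
    unfolding of_bool_mod_less_fourier[OF T assms(3)] a_def[symmetric]
    by (simp add: sum_divide_distrib sum_distrib_left sum_distrib_right mult_ac)
  also have "\<dots> = (\<Sum>h<Q. cnj (a h) * (\<Sum>m<K. of_real (w m) * cis (2 * j m * (pi * h / Q)))) / of_nat Q"
    by (subst sum.swap) (simp add: sum_distrib_left)
  finally have eq: "complex_of_real (\<Sum>m<K. w m * of_bool (frac (j m / Q) < t)) = \<dots>" .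
  have "\<bar>\<Sum>m<K. w m * of_bool (frac (j m / Q) < t)\<bar>
     = cmod (\<Sum>h<Q. cnj (a h) * (\<Sum>m<K. of_real (w m) * cis (2 * j m * (pi * h / Q)))) / Q"
    unfolding norm_of_real[symmetric, where 'a=complex] eq by (simp add: norm_divide)
  also have "\<dots> \<le> (\<Sum>h<Q. cmod (a h) * B) / Q"
  proof (intro divide_right_mono sum_norm_le)
    fix h
    show "cmod (cnj (a h) * (\<Sum>m<K. of_real (w m) * cis (2 * j m * (pi * h / Q)))) \<le> cmod (a h) * B"
      unfolding norm_mult complex_mod_cnj using B[of "pi * h / Q"] by (intro mult_left_mono) auto
  qed simp
  also have "\<dots> = (\<Sum>h<Q. cmod (a h)) * B / Q" by (simp add: sum_distrib_right)
  also have "\<dots> \<le> Q * (3 + 2 * ln Q) * B / Q"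
  proof (intro divide_right_mono mult_right_mono)
    show "(\<Sum>h<Q. cmod (a h)) \<le> Q * (3 + 2 * ln Q)"
      unfolding a_def by (rule lebesgue_constant_bound[OF T assms(3)])
    show "0 \<le> B" using B[of 0] norm_ge_zero by (rule order.trans[rotated])
  qed simp
  also have "\<dots> = B * (3 + 2 * ln Q)" using assms by simp
  finally show ?thesis .
qed

section \<open>Replacing the slope by a rational number\<close>

text \<open>The rational slope lowers \<open>k * \<alpha>\<close> by less than \<open>N / Q\<close>,
  so a floor changes only if \<open>k * \<alpha> - s\<close> lies that close above an integer. Two
  such indices would bring \<open>(k' - k) * \<alpha>\<close> within \<open>N / Q\<close> of an
  integer, which \<open>N * N \<le> c * Q\<close> excludes.\<close>

lemma sum_floor_perturbation:
  fixes \<alpha> s c :: real and N Q :: nat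
  assumes c: "\<And>(q::nat) (p::int). q \<ge> 1 \<Longrightarrow> c / q \<le> \<bar>q * \<alpha> - p\<bar>"
    and Q: "Q \<ge> 1" "N \<le> Q" "N * N \<le> c * Q"
  shows "(\<Sum>k<N. \<bar>\<lfloor>k * \<alpha> - s\<rfloor> - \<lfloor>k * \<lfloor>Q * \<alpha>\<rfloor> / Q - s\<rfloor>\<bar>) \<le> 1"
proof -
  define D where "D = (\<lambda>k::nat. \<bar>\<lfloor>k * \<alpha> - s\<rfloor> - \<lfloor>k * \<lfloor>Q * \<alpha>\<rfloor> / Q - s\<rfloor>\<bar>)"
  have D: "D k = 0 \<or> (D k = 1 \<and> frac (k * \<alpha> - s) < N / Q)" if k: "k < N" for k
  proof -
    define e where "e = k * \<alpha> - k * \<lfloor>Q * \<alpha>\<rfloor> / Q"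
    have "e = (k / Q) * (Q * \<alpha> - \<lfloor>Q * \<alpha>\<rfloor>)" using Q by (simp add: e_def field_simps)
    moreover have "0 \<le> Q * \<alpha> - \<lfloor>Q * \<alpha>\<rfloor>" "Q * \<alpha> - \<lfloor>Q * \<alpha>\<rfloor> \<le> 1" by linarith+
    ultimately have "0 \<le> e" "e \<le> k / Q" by (auto simp only: intro!: mult_left_le mult_nonneg_nonneg) auto
    moreover have "k / Q < N / Q" using k Q by (intro divide_strict_right_mono) auto
    moreover have "N / Q \<le> 1" using Q by simp
    ultimately have e: "0 \<le> e" "e < N / Q" "e < 1" by linarith+
    define u where "u = k * \<alpha> - s"
    have v: "k * \<lfloor>Q * \<alpha>\<rfloor> / Q - s = u - e" by (simp add: u_def e_def)
    show ?thesis unfolding D_def v u_def[symmetric]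
    proof (cases "\<lfloor>u - e\<rfloor> = \<lfloor>u\<rfloor>")
      case False
      then have "\<lfloor>u - e\<rfloor> < \<lfloor>u\<rfloor>" using e floor_mono[of "u - e" u] by linarith
      then have "\<lfloor>u - e\<rfloor> = \<lfloor>u\<rfloor> - 1" "frac u < N / Q"
        using e unfolding frac_def by linarith+
      then show "\<bar>\<lfloor>u\<rfloor> - \<lfloor>u - e\<rfloor>\<bar> = 0 \<or> \<bar>\<lfloor>u\<rfloor> - \<lfloor>u - e\<rfloor>\<bar> = 1 \<and> frac u < N / Q" by simp
    qed simp
  qed
  define A where "A = {k\<in>{..<N}. D k = 1}"
  have no: "\<not> k < k'" if "k \<in> A" "k' \<in> A" for k k'
  proof
    assume "k < k'"
    have f: "frac (k * \<alpha> - s) < N / Q" "frac (k' * \<alpha> - s) < N / Q" "k' < N"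
      using that D[of k] D[of k'] by (auto simp: A_def)
    define p where "p = \<lfloor>k' * \<alpha> - s\<rfloor> - \<lfloor>k * \<alpha> - s\<rfloor>"
    have "real (k' - k) * \<alpha> - p = frac (k' * \<alpha> - s) - frac (k * \<alpha> - s)"
      using \<open>k < k'\<close> by (simp add: frac_def p_def of_nat_diff algebra_simps)
    then have "\<bar>real (k' - k) * \<alpha> - p\<bar> < N / Q"
      using f frac_ge_0[of "k' * \<alpha> - s"] frac_ge_0[of "k * \<alpha> - s"] by linarith
    moreover have "c / real (k' - k) \<le> \<bar>real (k' - k) * \<alpha> - p\<bar>"
      using \<open>k < k'\<close> by (intro c) simp
    ultimately have "c / real (k' - k) < N / Q" by (metis order.strict_trans1)
    then have "c * Q < N * real (k' - k)" using \<open>k < k'\<close> Q by (simp add: field_simps)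
    also have "real N * real (k' - k) \<le> real N * real N" using f by (intro mult_left_mono) auto
    finally show False using Q by simp
  qed
  have "finite A" by (simp add: A_def)
  then have "card A \<le> Suc 0"
    unfolding card_le_Suc0_iff_eq[OF \<open>finite A\<close>] using no by (meson linorder_neqE_nat)
  moreover have "(\<Sum>k<N. D k) = (\<Sum>k<N. of_bool (k \<in> A))"
    using D by (intro sum.cong) (force simp: A_def)+
  then have "(\<Sum>k<N. D k) = int (card A)"
    by (simp add: A_def Int_def)
  ultimately show ?thesis by (simp add: D_def)
qed

section \<open>Dyadic intervals\<close>

definition radical_inverse :: "nat \<Rightarrow> real" where
  "radical_inverse m = (\<Sum>i. real (binary_digit m i) / 2 ^ (i + 1))"

lemma summable_digits:
  assumes "\<And>i. i > j \<Longrightarrow> y i = binary_digit k i"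
  shows "summable (\<lambda>i. real (y i) / 2 ^ (i + 1))"
proof (rule summable_finite)
  show "finite ({..j} \<union> {i. binary_digit k i \<noteq> 0})" using finite_binary_digits by simp
  show "real (y i) / 2 ^ (i + 1) = 0" if "i \<notin> {..j} \<union> {i. binary_digit k i \<noteq> 0}" for i
    using that assms[of i] by auto
qed

lemma suminf_digits_head:
  assumes "\<And>i. i > 0 \<Longrightarrow> y i = binary_digit k i"
  shows "(\<Sum>i. real (y i) / 2 ^ (i + 1)) = (y 0 + radical_inverse (k div 2)) / 2"
proof -
  have "(\<Sum>i. real (y i) / 2 ^ (i + 1)) = (\<Sum>i. real (y (Suc i)) / 2 ^ (Suc i + 1)) + y 0 / 2"
    using suminf_split_head[OF summable_digits[OF assms]] by simp
  also have "(\<Sum>i. real (y (Suc i)) / 2 ^ (Suc i + 1)) = (\<Sum>i. (real (binary_digit (k div 2) i) / 2 ^ (i + 1)) / 2)"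
    using assms by (simp add: binary_digit_Suc mult_ac)
  also have "\<dots> = radical_inverse (k div 2) / 2"
    unfolding radical_inverse_def by (rule suminf_divide) (rule summable_digits, simp)
  finally show ?thesis by simp
qed

lemma radical_inverse_rec: "radical_inverse m = (real (m mod 2) + radical_inverse (m div 2)) / 2"
  using suminf_digits_head[of "binary_digit m" m] by (simp add: radical_inverse_def binary_digit_0)

lemma radical_inverse_bounds: "0 \<le> radical_inverse m" "radical_inverse m < 1"
proof -
  have "0 \<le> radical_inverse m \<and> radical_inverse m < 1"
  proof (induction m rule: less_induct)
    case (less m)
    show ?case
    proof (cases "m = 0")
      case True
      then show ?thesis by (simp add: radical_inverse_def binary_digit_def)
    next
      case False
      then have "0 \<le> radical_inverse (m div 2) \<and> radical_inverse (m div 2) < 1" by (intro less.IH) simp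
      moreover have "m mod 2 < 2" by simp
      then have "real (m mod 2) \<le> 1" by linarith
      ultimately show ?thesis unfolding radical_inverse_rec[of m] by simp
    qed
  qed
  then show "0 \<le> radical_inverse m" "radical_inverse m < 1" by auto
qed

definition dyadic_interval :: "nat \<Rightarrow> nat \<Rightarrow> real set" where
  "dyadic_interval l b = {real b / 2 ^ l..<(real b + 1) / 2 ^ l}"

text \<open>The leading binary digit of \<open>b\<close> selects the half of the unit interval, the
  other digits the place of \<open>v\<close> after rescaling.\<close>

lemma dyadic_interval_half:
  fixes \<delta> b l :: nat and v :: real
  assumes "\<delta> < 2" "0 \<le> v" "v < 1" "b < 2 ^ Suc l"
  shows "(\<delta> + v) / 2 \<in> dyadic_interval (Suc l) b \<longleftrightarrow>
    \<delta> = b div 2 ^ l \<and> v \<in> dyadic_interval l (b mod 2 ^ l)"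
proof -
  define d b' where "d = b div 2 ^ l" and "b' = b mod 2 ^ l"
  have "d < 2" unfolding d_def using assms(4) by (intro less_mult_imp_div_less) simp
  have b': "b' < 2 ^ l" by (simp add: b'_def)
  have b: "real b = d * 2 ^ l + b'"
  proof -
    have "b = d * 2 ^ l + b'" unfolding d_def b'_def by (rule div_mult_mod_eq[symmetric])
    then show ?thesis by (metis of_nat_add of_nat_mult of_nat_numeral of_nat_power)
  qed
  have e: "real b / 2 ^ Suc l = (real d + real b' / 2 ^ l) / 2"
    "(real b + 1) / 2 ^ Suc l = (real d + (real b' + 1) / 2 ^ l) / 2"
    by (simp_all add: b field_simps)
  have "real b' + 1 \<le> 2 ^ l" using b' by (metis Suc_leI of_nat_Suc of_nat_le_iff of_nat_numeral of_nat_power add.commute)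
  then have r: "0 \<le> real b' / 2 ^ l" "(real b' + 1) / 2 ^ l \<le> 1" by (auto simp: add.commute)
  define u w where "u = real b' / 2 ^ l" and "w = (real b' + 1) / 2 ^ l"
  consider "\<delta> = d" | "\<delta> = 0" "d = 1" | "\<delta> = 1" "d = 0" using assms(1) \<open>d < 2\<close> by linarith
  then show ?thesis
    using r assms(2,3) unfolding dyadic_interval_def e d_def[symmetric] b'_def[symmetric]
      u_def[symmetric] w_def[symmetric]
    by cases auto
qed

lemma binary_digit_unique:
  fixes d d' t t' :: nat
  assumes "d < 2" "d' < 2"
  shows "d + 2 * t = d' + 2 * t' \<longleftrightarrow> d = d' \<and> t = t'"
  using assms by presburger

text \<open>The interval fixes the leading \<open>l\<close> digits of the radical inverse, which are
  the lowest \<open>l\<close> digits of \<open>m\<close>; \<open>r\<close> is \<open>b\<close> with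
  its digits reversed.\<close>

lemma radical_inverse_dyadic:
  assumes "b < 2 ^ l"
  obtains r where "r < 2 ^ l"
    "\<And>m. radical_inverse m \<in> dyadic_interval l b \<longleftrightarrow> m mod 2 ^ l = r"
proof -
  have "\<exists>r<2 ^ l. \<forall>m. radical_inverse m \<in> dyadic_interval l b \<longleftrightarrow> m mod 2 ^ l = r"
    using assms
  proof (induction l arbitrary: b)
    case 0
    then show ?case using radical_inverse_bounds by (auto simp: dyadic_interval_def)
  next
    case (Suc l)
    have "b mod 2 ^ l < 2 ^ l" by simp
    from Suc.IH[OF this] obtain r where r: "r < 2 ^ l"
      "\<And>m. radical_inverse m \<in> dyadic_interval l (b mod 2 ^ l) \<longleftrightarrow> m mod 2 ^ l = r"
      by auto
    define d where "d = b div 2 ^ l"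
    have d: "d < 2" unfolding d_def using Suc.prems by (intro less_mult_imp_div_less) simp
    have "radical_inverse m \<in> dyadic_interval (Suc l) b \<longleftrightarrow> m mod 2 ^ Suc l = d + 2 * r" for m
    proof -
      have "radical_inverse m \<in> dyadic_interval (Suc l) b
          \<longleftrightarrow> m mod 2 = d \<and> m div 2 mod 2 ^ l = r"
        unfolding radical_inverse_rec[of m] d_def
        by (subst dyadic_interval_half) (use Suc.prems radical_inverse_bounds r(2) in auto)
      also have "\<dots> \<longleftrightarrow> m mod 2 ^ Suc l = d + 2 * r"
      proof -
        have "m mod 2 ^ Suc l = m mod 2 + 2 * (m div 2 mod 2 ^ l)"
          using mod_mult2_eq[of m 2 "2 ^ l"] by simp
        then show ?thesis using binary_digit_unique[of "m mod 2" d] d by simp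
      qed
      finally show ?thesis .
    qed
    moreover have "d + 2 * r < 2 ^ Suc l" using d r(1) by simp
    ultimately show ?case by blast
  qed
  then show ?thesis using that by blast
qed

text \<open>Apart from its first row the matrix is the identity, so only the leading output digit
  differs from that of the radical inverse.\<close>

lemma perturbed_vdc_eq:
  "perturbed_vdc n k = (digital_output (perturbed_matrix n) k 0 + radical_inverse (k div 2)) / 2"
  unfolding perturbed_vdc_def
proof (rule suminf_digits_head)
  fix i :: nat assume "i > 0"
  then have "digital_output (perturbed_matrix n) k i
      = (\<Sum>j\<in>{j. binary_digit k j \<noteq> 0}. if j = i then binary_digit k j else 0) mod 2"
    unfolding digital_output_def perturbed_matrix_def by (intro arg_cong[of _ _ "\<lambda>x. x mod 2"] sum.cong) auto
  also have "\<dots> = binary_digit k i mod 2" using finite_binary_digits[of k] by simp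
  also have "\<dots> = binary_digit k i" by (simp add: binary_digit_def)
  finally show "digital_output (perturbed_matrix n) k i = binary_digit k i" .
qed

lemma digit_character_row_sign:
  "digit_character (row_sign n) k = (-1) ^ digital_output (perturbed_matrix n) k 0"
proof -
  have "digit_character (row_sign n) k = (\<Prod>j\<in>{j. binary_digit k j \<noteq> 0}. (-1) ^ (row_c n j * binary_digit k j))"
    unfolding digit_character_def
  proof (intro prod.cong refl)
    fix j assume "j \<in> {j. binary_digit k j \<noteq> 0}"
    then have "binary_digit k j = 1" by (auto simp: binary_digit_def)
    then show "row_sign n j = (-1) ^ (row_c n j * binary_digit k j)" by (simp add: row_sign_def row_c_def)
  qed
  also have "\<dots> = (-1) ^ (\<Sum>j\<in>{j. binary_digit k j \<noteq> 0}. row_c n j * binary_digit k j)"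
    by (rule power_sum[symmetric])
  also have "\<dots> = (-1) ^ ((\<Sum>j\<in>{j. binary_digit k j \<noteq> 0}. row_c n j * binary_digit k j) mod 2)"
    by (simp add: minus_one_power_iff)
  finally show ?thesis by (simp add: digital_output_def perturbed_matrix_def)
qed

lemma digital_output_less: "digital_output C k i < 2"
  by (simp add: digital_output_def)

lemma perturbed_vdc_bounds: "0 \<le> perturbed_vdc n k" "perturbed_vdc n k < 1"
  using radical_inverse_bounds[of "k div 2"] digital_output_less[of "perturbed_matrix n" k 0]
  by (auto simp: perturbed_vdc_eq)

text \<open>The interval prescribes the leading output digit and the class of \<open>k div 2\<close>
  modulo \<open>2 ^ l\<close>, while the lowest digit of \<open>k\<close> stays free; hence two
  residue classes. The prescribed output digit \<open>d\<close> enters through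
  \<open>s = (-1) ^ d\<close>.\<close>

lemma perturbed_vdc_dyadic:
  assumes "b < 2 ^ Suc l"
  obtains r s where "r < 2 ^ l" "s = 1 \<or> s = (-1::real)"
    "\<And>k. of_bool (perturbed_vdc n k \<in> dyadic_interval (Suc l) b)
        = (of_bool (k mod 2 ^ Suc l = 2 * r) + of_bool (k mod 2 ^ Suc l = 2 * r + 1))
            * ((1 + s * digit_character (row_sign n) k) / 2)"
proof -
  have "b mod 2 ^ l < 2 ^ l" by simp
  then obtain r where r: "r < 2 ^ l"
    "\<And>m. radical_inverse m \<in> dyadic_interval l (b mod 2 ^ l) \<longleftrightarrow> m mod 2 ^ l = r"
    using radical_inverse_dyadic by blast
  define d where "d = b div 2 ^ l"
  have d: "d < 2" unfolding d_def using assms by (intro less_mult_imp_div_less) simp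
  define s :: real where "s = (-1) ^ d"
  have "of_bool (perturbed_vdc n k \<in> dyadic_interval (Suc l) b)
        = (of_bool (k mod 2 ^ Suc l = 2 * r) + of_bool (k mod 2 ^ Suc l = 2 * r + 1))
            * ((1 + s * digit_character (row_sign n) k) / 2)" for k
  proof -
    let ?y = "digital_output (perturbed_matrix n) k 0"
    have "perturbed_vdc n k \<in> dyadic_interval (Suc l) b \<longleftrightarrow> ?y = d \<and> k div 2 mod 2 ^ l = r"
      unfolding perturbed_vdc_eq d_def
      by (subst dyadic_interval_half) (use assms radical_inverse_bounds digital_output_less r(2) in auto)
    moreover have "of_bool (?y = d) = (1 + s * digit_character (row_sign n) k) / 2"
    proof -
      have "?y \<in> {0, 1}" "d \<in> {0, 1}" using digital_output_less[of "perturbed_matrix n" k 0] d by auto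
      then show ?thesis unfolding digit_character_row_sign s_def by auto
    qed
    moreover have "(of_bool (k div 2 mod 2 ^ l = r) :: real)
        = of_bool (k mod 2 ^ Suc l = 2 * r) + of_bool (k mod 2 ^ Suc l = 2 * r + 1)"
    proof -
      have "k mod 2 ^ Suc l = k mod 2 + 2 * (k div 2 mod 2 ^ l)"
        using mod_mult2_eq[of k 2 "2 ^ l"] by simp
      then have "k div 2 mod 2 ^ l = r \<longleftrightarrow> k mod 2 ^ Suc l = 2 * r \<or> k mod 2 ^ Suc l = 2 * r + 1"
        using binary_digit_unique[of "k mod 2" 0 "k div 2 mod 2 ^ l" r]
          binary_digit_unique[of "k mod 2" 1 "k div 2 mod 2 ^ l" r] by auto
      then show ?thesis by auto
    qed
    ultimately show ?thesis by (simp only: of_bool_conj mult.commute)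
  qed
  moreover have "s = 1 \<or> s = -1" using d by (auto simp: s_def less_2_cases_iff)
  ultimately show ?thesis using that r(1) by blast
qed

section \<open>From elementary intervals to all anchored intervals\<close>

text \<open>The binary digits of \<open>X\<close> split the interval into at most one elementary
  interval for each of the \<open>L + 1\<close> levels, each with error at most \<open>E\<close>.
  The weight \<open>g\<close> will be the indicator in the second coordinate.\<close>

lemma dyadic_discrepancy:
  fixes s :: "nat \<Rightarrow> real" and g :: "nat \<Rightarrow> real" and V E :: real
  assumes s: "\<And>k. 0 \<le> s k"
    and el: "\<And>l b. l \<le> L \<Longrightarrow> b < 2 ^ l \<Longrightarrow>
      \<bar>(\<Sum>k<N. of_bool (s k \<in> dyadic_interval l b) * g k) - V / 2 ^ l\<bar> \<le> E"
    and X: "X \<le> 2 ^ L"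
  shows "\<bar>(\<Sum>k<N. of_bool (s k < real X / 2 ^ L) * g k) - V * (X / 2 ^ L)\<bar> \<le> (real L + 1) * E"
  using el X
proof (induction L arbitrary: X)
  case 0
  have E: "\<bar>(\<Sum>k<N. of_bool (s k < 1) * g k) - V\<bar> \<le> E"
    using 0(1)[of 0 0] s by (simp add: dyadic_interval_def)
  have "X = 0 \<or> X = 1" using 0 by auto
  then show ?case
  proof
    assume "X = 0"
    then show ?thesis using s E by (simp add: not_less[symmetric])
  next
    assume "X = 1"
    then show ?thesis using E by simp
  qed
next
  case (Suc L)
  define Y where "Y = X div 2"
  have Y: "Y \<le> 2 ^ L" using Suc.prems by (simp add: Y_def)
  have IH: "\<bar>(\<Sum>k<N. of_bool (s k < real Y / 2 ^ L) * g k) - V * (Y / 2 ^ L)\<bar> \<le> (real L + 1) * E"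
    by (rule Suc.IH) (use Suc.prems Y in auto)
  have E: "0 \<le> E" using Suc.prems(1)[of 0 0] abs_ge_zero by (rule order.trans[rotated]) auto
  show ?case
  proof (cases "even X")
    case True
    then have "real X = 2 * real Y" by (auto simp: Y_def)
    then have "real X / 2 ^ Suc L = Y / 2 ^ L" by simp
    moreover have "(real L + 1) * E \<le> (real (Suc L) + 1) * E" using E by (intro mult_right_mono) auto
    ultimately show ?thesis using IH by simp
  next
    case False
    then have X: "X = 2 * Y + 1" by (simp add: Y_def)
    have Xe: "real X / 2 ^ Suc L = (real (2 * Y) + 1) / 2 ^ Suc L" "Y / 2 ^ L = real (2 * Y) / 2 ^ Suc L"
      by (simp_all add: X)
    have "of_bool (s k < real X / 2 ^ Suc L) * g k = of_bool (s k < real Y / 2 ^ L) * g k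
        + of_bool (s k \<in> dyadic_interval (Suc L) (2 * Y)) * g k" for k
    proof -
      have "real (2 * Y) / 2 ^ Suc L \<le> (real (2 * Y) + 1) / 2 ^ Suc L" by (intro divide_right_mono) auto
      then show ?thesis unfolding Xe dyadic_interval_def by (auto simp del: of_nat_mult)
    qed
    then have "(\<Sum>k<N. of_bool (s k < real X / 2 ^ Suc L) * g k) = (\<Sum>k<N. of_bool (s k < real Y / 2 ^ L) * g k)
        + (\<Sum>k<N. of_bool (s k \<in> dyadic_interval (Suc L) (2 * Y)) * g k)"
      by (simp only: sum.distrib)
    moreover have "\<bar>(\<Sum>k<N. of_bool (s k \<in> dyadic_interval (Suc L) (2 * Y)) * g k)
        - V / 2 ^ Suc L\<bar> \<le> E"
      by (rule Suc.prems(1)) (use Suc.prems X in auto)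
    moreover have "V * (X / 2 ^ Suc L) = V * (Y / 2 ^ L) + V / 2 ^ Suc L"
      by (simp add: X field_simps)
    moreover have "(real (Suc L) + 1) * E = (real L + 1) * E + E" by (simp add: algebra_simps)
    ultimately show ?thesis using IH by linarith
  qed
qed

text \<open>\<open>x\<close> is enclosed between neighbouring multiples of \<open>1 / 2 ^ L\<close>.
  The weighted count is monotone because \<open>g \<ge> 0\<close>, and the two expected values
  differ by \<open>V / 2 ^ L \<le> 1\<close>.\<close>

lemma interval_discrepancy:
  fixes s :: "nat \<Rightarrow> real" and g :: "nat \<Rightarrow> real" and V E :: real
  assumes s: "\<And>k. 0 \<le> s k" and g: "\<And>k. 0 \<le> g k" and V: "0 \<le> V" "V \<le> 2 ^ L"
    and el: "\<And>l b. l \<le> L \<Longrightarrow> b < 2 ^ l \<Longrightarrow>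
      \<bar>(\<Sum>k<N. of_bool (s k \<in> dyadic_interval l b) * g k) - V / 2 ^ l\<bar> \<le> E"
    and x: "0 < x" "x \<le> 1"
  shows "\<bar>(\<Sum>k<N. of_bool (s k < x) * g k) - V * x\<bar> \<le> (real L + 1) * E + 1"
proof -
  define X where "X = nat \<lceil>x * 2 ^ L\<rceil>"
  define R where "R z = (\<Sum>k<N. of_bool (s k < z) * g k)" for z
  have "x * 2 ^ L \<le> 2 ^ L" using x by simp
  then have X2: "X \<le> 2 ^ L" by (simp add: X_def ceiling_le_iff)
  have pos: "x * 2 ^ L > 0" using x by simp
  then have c: "0 < \<lceil>x * 2 ^ L\<rceil>" by simp
  then have X1: "X \<ge> 1" unfolding X_def by linarith
  have "real X = \<lceil>x * 2 ^ L\<rceil>" using c by (simp add: X_def)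
  then have Xb: "x * 2 ^ L \<le> real X" "real X - 1 < x * 2 ^ L" by linarith+
  have xb: "x \<le> real X / 2 ^ L" "real (X - 1) / 2 ^ L \<le> x"
    using Xb X1 by (simp_all add: field_simps of_nat_diff)
  have mono: "R z \<le> R z'" if "z \<le> z'" for z z'
    unfolding R_def using that g by (intro sum_mono mult_right_mono) auto
  have "\<bar>R (real X / 2 ^ L) - V * (real X / 2 ^ L)\<bar> \<le> (real L + 1) * E"
    unfolding R_def by (rule dyadic_discrepancy) (use s el X2 in auto)
  moreover have "\<bar>R (real (X - 1) / 2 ^ L) - V * (real (X - 1) / 2 ^ L)\<bar> \<le> (real L + 1) * E"
    unfolding R_def by (rule dyadic_discrepancy) (use s el X2 in auto)
  moreover have "V * (real X / 2 ^ L) = V * (real (X - 1) / 2 ^ L) + V / 2 ^ L"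
    using X1 by (simp add: field_simps of_nat_diff)
  moreover have "V / 2 ^ L \<le> 1" using V by simp
  moreover have "V * (real (X - 1) / 2 ^ L) \<le> V * x" "V * x \<le> V * (real X / 2 ^ L)"
    by (rule mult_left_mono[OF xb(2) V(1)] mult_left_mono[OF xb(1) V(1)])+
  moreover have "R (real (X - 1) / 2 ^ L) \<le> R x" "R x \<le> R (real X / 2 ^ L)"
    using xb mono by auto
  ultimately show ?thesis unfolding R_def[symmetric] by linarith
qed

section \<open>Residue classes\<close>

lemma sum_residue_class:
  fixes b \<rho> N :: nat
  assumes "\<rho> < b"
  obtains K where "K \<le> N" "\<bar>real K - real N / b\<bar> \<le> 1"
    "\<And>f :: nat \<Rightarrow> real. (\<Sum>k<N. of_bool (k mod b = \<rho>) * f k) = (\<Sum>m<K. f (\<rho> + b * m))"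
proof -
  \<comment> \<open>Adding \<open>b - 1 - \<rho>\<close> rounds \<open>(N - \<rho>) / b\<close> up
    and yields 0 when \<open>N \<le> \<rho>\<close>.\<close>
  define K where "K = (N + (b - 1 - \<rho>)) div b"
  have b: "b > 0" using assms by simp
  have K: "m < K \<longleftrightarrow> \<rho> + b * m < N" for m
  proof -
    have "m < K \<longleftrightarrow> Suc m * b \<le> N + (b - 1 - \<rho>)"
      unfolding K_def using b by (simp add: less_eq_div_iff_mult_less_eq flip: Suc_le_eq)
    also have "\<dots> \<longleftrightarrow> \<rho> + b * m < N" using assms by (auto simp: mult.commute)
    finally show ?thesis .
  qed
  have sums: "(\<Sum>k<N. of_bool (k mod b = \<rho>) * f k) = (\<Sum>m<K. f (\<rho> + b * m))" for f :: "nat \<Rightarrow> real"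
  proof -
    have "(\<Sum>k<N. of_bool (k mod b = \<rho>) * f k) = (\<Sum>k\<in>{k\<in>{..<N}. k mod b = \<rho>}. f k)"
      by (subst sum.inter_filter) (simp, intro sum.cong, auto)
    also have "\<dots> = (\<Sum>m<K. f (\<rho> + b * m))"
    proof (rule sum.reindex_bij_witness[of _ "\<lambda>m. \<rho> + b * m" "\<lambda>k. k div b"])
      fix k assume k: "k \<in> {k\<in>{..<N}. k mod b = \<rho>}"
      then have e: "\<rho> + b * (k div b) = k" using mod_mult_div_eq[of k b] by simp
      then show "\<rho> + b * (k div b) = k" "f (\<rho> + b * (k div b)) = f k" by simp_all
      show "k div b \<in> {..<K}" using K[of "k div b"] e k by simp
    next
      fix m assume "m \<in> {..<K}"
      then show "\<rho> + b * m \<in> {k\<in>{..<N}. k mod b = \<rho>}" "(\<rho> + b * m) div b = m"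
        using K[of m] assms by auto
    qed
    finally show ?thesis .
  qed
  have "K * b \<le> N + (b - 1 - \<rho>)" unfolding K_def by (rule div_times_less_eq_dividend)
  then have "K * b \<le> N + b" by linarith
  then have "real K * b \<le> N + b" by (metis of_nat_le_iff of_nat_mult of_nat_add)
  then have up: "real K \<le> N / b + 1" using b by (simp add: field_simps)
  have "N \<le> \<rho> + b * K" using K[of K] by simp
  then have "N \<le> b + b * K" using assms by linarith
  then have "real N \<le> b + b * real K" by (metis of_nat_le_iff of_nat_mult of_nat_add)
  then have low: "real N / b \<le> K + 1" using b by (simp add: field_simps)
  have "K \<le> N"
  proof (cases "K = 0")
    case False
    then have "\<rho> + b * (K - 1) < N" using K[of "K - 1"] by simp
    moreover have "1 * (K - 1) \<le> b * (K - 1)" using b by (intro mult_right_mono) auto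
    ultimately show ?thesis by linarith
  qed simp
  with up low sums show ?thesis by (intro that) (auto simp: abs_le_iff)
qed

text \<open>Within the class the points form a Kronecker sequence with rotation
  \<open>b * \<alpha>\<close>. Dirichlet's theorem provides a period \<open>q\<close> of at most
  about \<open>sqrt N\<close>, and bad approximability forces \<open>q * b \<ge> c * sqrt N\<close>,
  so at most \<open>3 / c * sqrt N\<close> periods occur, whatever \<open>l\<close> is.\<close>

lemma class_count_kronecker:
  fixes \<alpha> c t :: real and N l \<rho> :: nat
  assumes c: "c > 0" "\<And>(q::nat) (p::int). q \<ge> 1 \<Longrightarrow> c / q \<le> \<bar>q * \<alpha> - p\<bar>"
    and t: "0 \<le> t" "t \<le> 1" and N: "N \<ge> 1" "2 ^ l \<le> 2 * N" and \<rho>: "\<rho> < 2 ^ l"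
  shows "\<bar>(\<Sum>k<N. of_bool (k mod 2 ^ l = \<rho>) * of_bool (frac (k * \<alpha>) < t)) - N * t / 2 ^ l\<bar>
           \<le> (12 / c + 3) * sqrt N"
proof -
  define b :: nat where "b = 2 ^ l"
  have b: "b \<ge> 1" "real b \<le> 2 * N"
    using N(2) unfolding b_def by (simp, metis of_nat_le_iff of_nat_mult of_nat_numeral)
  have "\<rho> < b" using \<rho> by (simp add: b_def)
  then obtain K where "K \<le> N" and K: "\<bar>real K - real N / b\<bar> \<le> 1"
    "\<And>f :: nat \<Rightarrow> real. (\<Sum>k<N. of_bool (k mod b = \<rho>) * f k) = (\<Sum>m<K. f (\<rho> + b * m))"
    by (rule sum_residue_class[where N = N]) (rule that)
  \<comment> \<open>\<open>sqrt N\<close> balances the two error terms \<open>4 * (K / q)\<close>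
    and \<open>q\<close>.\<close>
  define Q0 where "Q0 = nat \<lceil>sqrt N\<rceil>"
  have sN: "sqrt N \<ge> 1" using N by simp
  have Q0: "Q0 > 0" "sqrt N \<le> Q0" "Q0 \<le> sqrt N + 1"
    using sN unfolding Q0_def by linarith+
  obtain h k where hk: "coprime h k" "0 < k" "k \<le> int Q0" "\<bar>of_int k * (b * \<alpha>) - of_int h\<bar> < 1 / Q0"
    using Dirichlet_approx_coprime[OF Q0(1), of "b * \<alpha>"] by blast
  define q where "q = nat k"
  have q: "q > 0" "q \<le> Q0" "of_int k = real q" "k = int q" using hk by (auto simp: q_def)
  have "1 / Q0 \<le> 1 / q" using q by (simp add: frac_le)
  then have cnt: "\<bar>(\<Sum>m<K. of_bool (frac (\<rho> * \<alpha> + m * (b * \<alpha>)) < t)) - K * t\<bar> \<le> 4 * (K / q) + q"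
    using hk q t by (intro kronecker_count[of h]) auto
  have "c / real (q * b) \<le> \<bar>real (q * b) * \<alpha> - h\<bar>" using q b by (intro c(2)) simp
  also have "\<dots> < 1 / Q0" using hk(4) unfolding q(3) by (simp add: mult.assoc)
  also have "\<dots> \<le> 1 / sqrt N" using Q0 N by (intro frac_le) auto
  finally have "c * sqrt N \<le> q * b" using q b sN by (simp add: field_simps)
  then have "1 / q \<le> b / (c * sqrt N)" using q c sN by (simp add: field_simps)
  moreover have "real K \<le> (N + b) / b" using K(1) b by (simp add: field_simps abs_le_iff)
  ultimately have "real K * (1 / q) \<le> ((N + b) / b) * (b / (c * sqrt N))"
    by (intro mult_mono) auto
  also have "\<dots> = (N + b) / (c * sqrt N)" using b by simp
  \<comment> \<open>The modulus \<open>b\<close> has cancelled from the denominator;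
    \<open>b \<le> 2 * N\<close> absorbs the possible extra element of the class.\<close>
  also have "\<dots> \<le> (3 * N) / (c * sqrt N)" using b c by (intro divide_right_mono) auto
  also have "\<dots> = 3 / c * (N / sqrt N)" by simp
  also have "N / sqrt N = sqrt N" by (rule real_div_sqrt) simp
  finally have Kq: "K / q \<le> 3 / c * sqrt N" by simp
  have "\<bar>real K - real N / b\<bar> * t \<le> 1 * 1" using K(1) t by (intro mult_mono) auto
  moreover have "K * t - N * t / b = (real K - real N / b) * t" by (simp add: algebra_simps)
  ultimately have "\<bar>K * t - N * t / b\<bar> \<le> 1"
    using t by (simp add: abs_mult)
  moreover have "(\<Sum>k<N. of_bool (k mod 2 ^ l = \<rho>) * of_bool (frac (k * \<alpha>) < t))
      = (\<Sum>m<K. of_bool (frac (\<rho> * \<alpha> + m * (b * \<alpha>)) < t) :: real)"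
    unfolding b_def[symmetric] K(2) by (simp add: algebra_simps)
  moreover have "real q \<le> sqrt N + 1" using q Q0 by linarith
  moreover have "(12 / c + 3) * sqrt N = 4 * (3 / c * sqrt N) + 3 * sqrt N" by (simp add: algebra_simps)
  moreover have "real (2 ^ l) = 2 ^ l" by simp
  ultimately show ?thesis using cnt Kq sN unfolding b_def by (simp only:)
qed

text \<open>The indicator is a difference of two floors, and each of them changes for at most one
  index.\<close>

lemma of_bool_frac_perturbation:
  fixes \<alpha> c t :: real and N Q :: nat
  assumes c: "\<And>(q::nat) (p::int). q \<ge> 1 \<Longrightarrow> c / q \<le> \<bar>q * \<alpha> - p\<bar>"
    and Q: "Q \<ge> 1" "N \<le> Q" "N * N \<le> c * Q" and t: "0 \<le> t" "t \<le> 1"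
  shows "(\<Sum>k<N. \<bar>of_bool (frac (k * \<alpha>) < t) - of_bool (frac (int k * \<lfloor>Q * \<alpha>\<rfloor> / Q) < t)\<bar>) \<le> (2::real)"
proof -
  define D where "D s k = \<bar>\<lfloor>k * \<alpha> - s\<rfloor> - \<lfloor>k * \<lfloor>Q * \<alpha>\<rfloor> / Q - s\<rfloor>\<bar>" for s :: real and k :: nat
  have "(\<Sum>k<N. \<bar>of_bool (frac (k * \<alpha>) < t) - of_bool (frac (int k * \<lfloor>Q * \<alpha>\<rfloor> / Q) < t)\<bar>)
      \<le> (\<Sum>k<N. real_of_int (D 0 k + D t k))"
    unfolding of_bool_frac_less[OF t] by (intro sum_mono) (auto simp: D_def)
  also have "\<dots> = real_of_int ((\<Sum>k<N. D 0 k) + (\<Sum>k<N. D t k))" by (simp add: sum.distrib)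
  also have "\<dots> \<le> real_of_int (1 + 1)"
    unfolding of_int_le_iff D_def by (intro add_mono sum_floor_perturbation[OF c Q])
  finally show ?thesis by simp
qed

text \<open>Along the class the character and the exponential both split off a factor depending on
  \<open>\<rho>\<close> alone, which leaves the exponential sum for weights shifted by
  \<open>l\<close>. The Fourier bound applies to the rational slope; the final 2 pays for restoring
  \<open>\<alpha>\<close>.\<close>

lemma class_twisted_bound:
  fixes \<alpha> c t :: real and N l \<rho> Q :: nat
  assumes c: "\<And>(q::nat) (p::int). q \<ge> 1 \<Longrightarrow> c / q \<le> \<bar>q * \<alpha> - p\<bar>"
    and Q: "Q \<ge> 1" "N \<le> Q" "N * N \<le> c * Q" and t: "0 \<le> t" "t \<le> 1"
    and n: "n \<ge> 1" and N: "N < 2 ^ L" and \<rho>: "\<rho> < 2 ^ l"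
  shows "\<bar>\<Sum>k<N. of_bool (k mod 2 ^ l = \<rho>) *
      (digit_character (row_sign n) k * of_bool (frac (k * \<alpha>) < t))\<bar>
           \<le> L * (2 ^ (3 * n + 1) * kappa n ^ (L div n)) * (3 + 2 * ln Q) + 2"
proof -
  define w where "w = digit_character (row_sign n)"
  define p where "p = \<lfloor>Q * \<alpha>\<rfloor>"
  define B where "B = real L * (2 ^ (3 * n + 1) * kappa n ^ (L div n))"
  have chi: "\<bar>w k\<bar> \<le> 1" for k
    unfolding w_def by (rule abs_digit_character_le) (simp add: abs_row_sign)
  obtain K where K: "K \<le> N"
    "\<And>f :: nat \<Rightarrow> real. (\<Sum>k<N. of_bool (k mod 2 ^ l = \<rho>) * f k) = (\<Sum>m<K. f (\<rho> + 2 ^ l * m))"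
    using sum_residue_class[OF \<rho>, of N] by metis
  have KL: "K < 2 ^ L" using K N by linarith
  have "\<bar>\<Sum>m<K. w (\<rho> + 2 ^ l * m) * of_bool (frac ((int (\<rho> + 2 ^ l * m) * p) / Q) < t)\<bar> \<le> B * (3 + 2 * ln Q)"
  proof (rule weighted_count_rational_bound[OF t Q(1)])
    fix y :: real
    have "(\<Sum>m<K. complex_of_real (w (\<rho> + 2 ^ l * m)) * cis (2 * real_of_int (int (\<rho> + 2 ^ l * m) * p) * y))
      = of_real (w \<rho>) * cis (2 * \<rho> * p * y) * digit_exp_sum (\<lambda>j. row_sign n (l + j)) K (2 ^ l * p * y)"
      unfolding digit_exp_sum_def sum_distrib_left w_def digit_character_shift[OF \<rho>]
    proof (intro sum.cong refl)
      fix m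
      have "cis (2 * real_of_int (int (\<rho> + 2 ^ l * m) * p) * y)
         = cis (2 * \<rho> * p * y) * cis (2 * real m * (2 ^ l * p * y))"
        by (simp add: cis_mult algebra_simps)
      then show "complex_of_real (digit_character (row_sign n) \<rho> * digit_character (\<lambda>j. row_sign n (l + j)) m) *
          cis (2 * real_of_int (int (\<rho> + 2 ^ l * m) * p) * y) =
         of_real (digit_character (row_sign n) \<rho>) * cis (2 * \<rho> * p * y) *
          (of_real (digit_character (\<lambda>j. row_sign n (l + j)) m) * cis (2 * real m * (2 ^ l * p * y)))"
        by (simp only: of_real_mult mult_ac)
    qed
    then have "cmod (\<Sum>m<K. complex_of_real (w (\<rho> + 2 ^ l * m)) *
        cis (2 * real_of_int (int (\<rho> + 2 ^ l * m) * p) * y))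
       = \<bar>w \<rho>\<bar> * cmod (digit_exp_sum (\<lambda>j. row_sign n (l + j)) K (2 ^ l * p * y))"
      by (simp add: norm_mult)
    also have "\<dots> \<le> 1 * B"
      unfolding B_def by (intro mult_mono row_exp_sum_bound n KL chi) auto
    finally show "cmod (\<Sum>m<K. complex_of_real (w (\<rho> + 2 ^ l * m)) *
        cis (2 * real_of_int (int (\<rho> + 2 ^ l * m) * p) * y)) \<le> B"
      by simp
  qed
  then have A: "\<bar>\<Sum>k<N. of_bool (k mod 2 ^ l = \<rho>) * (w k * of_bool (frac (int k * p / Q) < t))\<bar> \<le> B * (3 + 2 * ln Q)"
    unfolding K(2) .
  have "\<bar>(\<Sum>k<N. of_bool (k mod 2 ^ l = \<rho>) * (w k * of_bool (frac (k * \<alpha>) < t)))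
      - (\<Sum>k<N. of_bool (k mod 2 ^ l = \<rho>) * (w k * of_bool (frac (int k * p / Q) < t)))\<bar>
      \<le> (\<Sum>k<N. \<bar>of_bool (frac (k * \<alpha>) < t) - of_bool (frac (int k * p / Q) < t)\<bar>)"
    unfolding sum_subtractf[symmetric]
  proof (rule order.trans[OF sum_abs sum_mono])
    fix k
    have "\<bar>of_bool (k mod 2 ^ l = \<rho>) * (w k * of_bool (frac (k * \<alpha>) < t))
        - of_bool (k mod 2 ^ l = \<rho>) * (w k * of_bool (frac (int k * p / Q) < t))\<bar>
      = \<bar>of_bool (k mod 2 ^ l = \<rho>) * w k\<bar> * \<bar>of_bool (frac (k * \<alpha>) < t) - of_bool (frac (int k * p / Q) < t)\<bar>"
      unfolding abs_mult[symmetric] by (simp only: algebra_simps)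
    also have "\<dots> \<le> 1 * \<bar>of_bool (frac (k * \<alpha>) < t) - of_bool (frac (int k * p / Q) < t)\<bar>"
      using chi[of k] by (intro mult_right_mono) auto
    finally show "\<bar>of_bool (k mod 2 ^ l = \<rho>) * (w k * of_bool (frac (k * \<alpha>) < t))
        - of_bool (k mod 2 ^ l = \<rho>) * (w k * of_bool (frac (int k * p / Q) < t))\<bar>
      \<le> \<bar>of_bool (frac (k * \<alpha>) < t) - of_bool (frac (int k * p / Q) < t)\<bar>" by simp
  qed
  also have "\<dots> \<le> 2" unfolding p_def by (rule of_bool_frac_perturbation[OF c Q t])
  finally show ?thesis using A unfolding w_def B_def by linarith
qed

section \<open>The discrepancy bound\<close>

lemma abs_average_diff_le:
  fixes s1 s2 t1 t2 v w a b :: real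
  assumes "\<bar>s1 - v\<bar> \<le> a" "\<bar>s2 - v\<bar> \<le> a" "\<bar>t1\<bar> \<le> b" "\<bar>t2\<bar> \<le> b" "\<bar>w\<bar> \<le> \<bar>t1\<bar> + \<bar>t2\<bar>"
  shows "\<bar>(s1 + s2 + w) / 2 - v\<bar> \<le> a + b"
proof -
  have "\<bar>w\<bar> \<le> 2 * b" using assms(3-5) by linarith
  note bounds = this[THEN abs_le_D1] this[THEN abs_le_D2] assms(1,2)[THEN abs_le_D1] assms(1,2)[THEN abs_le_D2]
  show ?thesis by (rule abs_leI) (use bounds in \<open>simp_all add: field_simps\<close>)
qed

text \<open>The average of the untwisted counts over the two residue classes reproduces
  \<open>N * t / 2 ^ l\<close> up to the Kronecker error; the twisted sums enter purely as
  error.\<close>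

lemma elementary_box_discrepancy:
  fixes \<alpha> c t :: real and N l L n b Q :: nat
  assumes c: "c > 0" "\<And>(q::nat) (p::int). q \<ge> 1 \<Longrightarrow> c / q \<le> \<bar>q * \<alpha> - p\<bar>"
    and Q: "Q \<ge> 1" "N \<le> Q" "N * N \<le> c * Q" and t: "0 \<le> t" "t \<le> 1"
    and n: "n \<ge> 1" and N: "N \<ge> 1" "N < 2 ^ L" "2 ^ L \<le> 2 * N" and l: "l \<le> L" and b: "b < 2 ^ l"
  shows "\<bar>(\<Sum>k<N. of_bool (perturbed_vdc n k \<in> dyadic_interval l b) *
      of_bool (frac (k * \<alpha>) < t)) - N * t / 2 ^ l\<bar>
     \<le> (12 / c + 3) * sqrt N + (L * (2 ^ (3 * n + 1) * kappa n ^ (L div n)) * (3 + 2 * ln Q) + 2)"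
proof -
  define E1 where "E1 = (12 / c + 3) * sqrt N"
  define E2 where "E2 = L * (2 ^ (3 * n + 1) * kappa n ^ (L div n)) * (3 + 2 * ln Q) + 2"
  define g :: "nat \<Rightarrow> real" where "g k = of_bool (frac (k * \<alpha>) < t)" for k
  define w where "w = digit_character (row_sign n)"
  have "(2::nat) ^ l \<le> 2 ^ L" using l by (intro power_increasing) auto
  then have l2: "2 ^ l \<le> 2 * N" using N by linarith
  have A: "\<bar>(\<Sum>k<N. of_bool (k mod 2 ^ l = \<rho>) * g k) - N * t / 2 ^ l\<bar> \<le> E1" if "\<rho> < 2 ^ l" for \<rho>
    unfolding E1_def g_def by (rule class_count_kronecker[OF c t N(1) l2 that])
  have B: "\<bar>\<Sum>k<N. of_bool (k mod 2 ^ l = \<rho>) * (w k * g k)\<bar> \<le> E2" if "\<rho> < 2 ^ l" for \<rho>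
    unfolding E2_def g_def w_def by (rule class_twisted_bound[OF c(2) Q t n N(2) that])
  have "\<bar>(\<Sum>k<N. of_bool (perturbed_vdc n k \<in> dyadic_interval l b) * g k) - N * t / 2 ^ l\<bar> \<le> E1 + E2"
  \<comment> \<open>At level 0 no leading digit is prescribed, and the untwisted count over all
    \<open>k\<close> suffices.\<close>
  proof (cases l)
    case 0
    then have "of_bool (perturbed_vdc n k \<in> dyadic_interval l b) = (of_bool (k mod 2 ^ l = 0) :: real)" for k
      using b perturbed_vdc_bounds[of n k] by (simp add: dyadic_interval_def)
    then have "(\<Sum>k<N. of_bool (perturbed_vdc n k \<in> dyadic_interval l b) * g k)
        = (\<Sum>k<N. of_bool (k mod 2 ^ l = 0) * g k)" by (simp only:)
    moreover have "0 \<le> E2" using B[of 0] by (rule order.trans[rotated]) auto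
    moreover have "\<bar>(\<Sum>k<N. of_bool (k mod 2 ^ l = 0) * g k) - N * t / 2 ^ l\<bar> \<le> E1" by (rule A) simp
    ultimately show ?thesis by linarith
  next
    case (Suc l')
    obtain r s where r: "r < 2 ^ l'" and s: "s = 1 \<or> s = (-1::real)" and
      ind: "\<And>k. of_bool (perturbed_vdc n k \<in> dyadic_interval l b)
        = (of_bool (k mod 2 ^ l = 2 * r) + of_bool (k mod 2 ^ l = 2 * r + 1)) * ((1 + s * w k) / 2)"
      using perturbed_vdc_dyadic[of b l' n] b unfolding Suc w_def by metis
    define S where "S \<rho> = (\<Sum>k<N. of_bool (k mod 2 ^ l = \<rho>) * g k)" for \<rho>
    define T where "T \<rho> = (\<Sum>k<N. of_bool (k mod 2 ^ l = \<rho>) * (w k * g k))" for \<rho>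
    define W where "W = s * (T (2 * r) + T (2 * r + 1))"
    have "(\<Sum>k<N. of_bool (perturbed_vdc n k \<in> dyadic_interval l b) * g k)
        = (S (2 * r) + S (2 * r + 1) + W) / 2"
      unfolding W_def ind S_def T_def sum.distrib[symmetric] sum_distrib_left sum_divide_distrib
      by (intro sum.cong refl) (simp add: field_simps)
    moreover have r2: "2 * r < 2 ^ l" "2 * r + 1 < 2 ^ l" using r by (simp_all add: Suc)
    have "\<bar>S (2 * r) - N * t / 2 ^ l\<bar> \<le> E1" "\<bar>S (2 * r + 1) - N * t / 2 ^ l\<bar> \<le> E1"
      unfolding S_def using A r2 by blast+
    moreover have "\<bar>T (2 * r)\<bar> \<le> E2" "\<bar>T (2 * r + 1)\<bar> \<le> E2"
      unfolding T_def using B r2 by blast+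
    moreover have "\<bar>W\<bar> \<le> \<bar>T (2 * r)\<bar> + \<bar>T (2 * r + 1)\<bar>"
      using s abs_triangle_ineq[of "T (2 * r)" "T (2 * r + 1)"] by (auto simp: W_def abs_mult)
    ultimately show ?thesis using abs_average_diff_le by (simp only:)
  qed
  then show ?thesis by (simp add: g_def E1_def E2_def)
qed

text \<open>The second side of the box is fixed first: its indicator is the weight in
  \<open>interval_discrepancy\<close>, with \<open>V = N * x2\<close>.\<close>

lemma star_discrepancy_bound:
  fixes \<alpha> c :: real and N L n Q :: nat
  assumes c: "c > 0" "\<And>(q::nat) (p::int). q \<ge> 1 \<Longrightarrow> c / q \<le> \<bar>q * \<alpha> - p\<bar>"
    and Q: "Q \<ge> 1" "N \<le> Q" "N * N \<le> c * Q"
    and n: "n \<ge> 1" and N: "N \<ge> 1" "N < 2 ^ L" "2 ^ L \<le> 2 * N"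
  shows "\<bar>N * star_discrepancy (perturbed_halton_kronecker n \<alpha>) N\<bar> \<le> (real L + 1) *
     ((12 / c + 3) * sqrt N + (L * (2 ^ (3 * n + 1) * kappa n ^ (L div n)) * (3 + 2 * ln Q) + 2)) + 1"
    (is "_ \<le> ?B")
proof -
  have box: "1 / real N * \<bar>real (card {k. k < N \<and>
      perturbed_halton_kronecker n \<alpha> k \<in> {0..<x1} \<times> {0..<x2}}) - real N * x1 * x2\<bar> \<le> ?B / N"
    if x: "0 < x1" "x1 \<le> 1" "0 < x2" "x2 \<le> 1" for x1 x2
  proof -
    have "{k. k < N \<and> perturbed_halton_kronecker n \<alpha> k \<in> {0..<x1} \<times> {0..<x2}}
        = {k\<in>{..<N}. perturbed_vdc n k < x1 \<and> frac (k * \<alpha>) < x2}"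
      using perturbed_vdc_bounds by (auto simp: perturbed_halton_kronecker_def)
    then have "real (card {k. k < N \<and> perturbed_halton_kronecker n \<alpha> k \<in> {0..<x1} \<times> {0..<x2}})
        = (\<Sum>k<N. of_bool (perturbed_vdc n k < x1 \<and> frac (k * \<alpha>) < x2))"
      by (simp add: Int_def)
    also have "\<dots> = (\<Sum>k<N. of_bool (perturbed_vdc n k < x1) * of_bool (frac (k * \<alpha>) < x2))"
      by (simp only: of_bool_conj)
    finally have card: "real (card {k. k < N \<and> perturbed_halton_kronecker n \<alpha> k \<in> {0..<x1} \<times> {0..<x2}}) = \<dots>" .
    have NL: "real N \<le> 2 ^ L" using N(2) by (metis less_imp_le of_nat_le_iff of_nat_numeral of_nat_power)
    have "real N * x2 \<le> N" using x by (simp add: mult_left_le)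
    then have V: "0 \<le> N * x2" "N * x2 \<le> 2 ^ L" using x NL by (simp, linarith)
    have "\<bar>(\<Sum>k<N. of_bool (perturbed_vdc n k < x1) * of_bool (frac (k * \<alpha>) < x2)) - (N * x2) * x1\<bar> \<le>
      (real L + 1) * ((12 / c + 3) * sqrt N + (L * (2 ^ (3 * n + 1) * kappa n ^ (L div n)) * (3 + 2 * ln Q) + 2)) + 1"
      using x by (intro interval_discrepancy V elementary_box_discrepancy c Q n N) (auto simp: perturbed_vdc_bounds)
    moreover have "N * x1 * x2 = (N * x2) * x1" by simp
    ultimately show ?thesis unfolding card times_divide_eq_left mult_1_left
      by (intro divide_right_mono) (simp_all only: of_nat_0_le_iff)
  qed
  have "\<bar>star_discrepancy (perturbed_halton_kronecker n \<alpha>) N\<bar> \<le> ?B / N"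
    unfolding star_discrepancy_def
  proof (rule cSup_abs_le)
    show "\<bar>d\<bar> \<le> ?B / N" if "d \<in> (\<lambda>(x1, x2). 1 / real N * \<bar>real (card {k. k < N \<and>
       perturbed_halton_kronecker n \<alpha> k \<in> {0..<x1} \<times> {0..<x2}}) - real N * x1 * x2\<bar>) ` ({0<..1} \<times> {0<..1})" for d
      using that box by auto
    show "(\<lambda>(x1, x2). 1 / real N * \<bar>real (card {k. k < N \<and>
       perturbed_halton_kronecker n \<alpha> k \<in> {0..<x1} \<times> {0..<x2}}) - real N * x1 * x2\<bar>) ` ({0<..1} \<times> {0<..1}) \<noteq> {}"
      by auto
  qed
  then show ?thesis using N by (simp add: abs_mult field_simps)
qed

section \<open>Comparison with powers of N\<close>

lemma kappa_powr:
  assumes "n \<ge> 1"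
  shows "kappa n = (2 ^ n) powr discrepancy_exponent n"
proof -
  have "(1::real) < 2 ^ n" using assms by (intro one_less_power) auto
  then show ?thesis
    unfolding discrepancy_exponent_def kappa_def[symmetric] using kappa_angle(6)[of n] by simp
qed

text \<open>This is what lets the main term absorb the Kronecker error of order
  \<open>sqrt N\<close>.\<close>

lemma discrepancy_exponent_ge_half:
  assumes "n \<ge> 1"
  shows "1 / 2 \<le> discrepancy_exponent n"
proof -
  have b: "(1::real) < 2 ^ n" using assms by (intro one_less_power) auto
  have "(2 ^ n) powr (1 / 2) \<le> kappa n"
    using kappa_sq_ge[of n] kappa_angle(6)[of n] by (simp add: powr_half_sqrt real_le_lsqrt)
  then have "log (2 ^ n) ((2 ^ n) powr (1 / 2)) \<le> log (2 ^ n) (kappa n)"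
    using b kappa_angle(6)[of n] by (subst log_le_cancel_iff) auto
  then show ?thesis using b by (simp add: discrepancy_exponent_def kappa_def)
qed

text \<open>\<open>kappa n\<close> is the power of \<open>2 ^ n\<close> with exponent
  \<open>discrepancy_exponent n\<close>, and \<open>n * (L div n) \<le> L\<close>, so the left side
  is at most that power of \<open>2 ^ L\<close>.\<close>

lemma kappa_power_div_le:
  assumes n: "n \<ge> 1" and N: "2 ^ L \<le> 2 * N"
  shows "kappa n ^ (L div n) \<le> 2 powr discrepancy_exponent n * real N powr discrepancy_exponent n"
proof -
  define a where "a = discrepancy_exponent n"
  have a: "a \<ge> 0" using discrepancy_exponent_ge_half[OF n] by (simp add: a_def)
  have "kappa n ^ (L div n) = (2 ^ n) powr (a * real (L div n))"
    unfolding kappa_powr[OF n] a_def[symmetric] powr_powr[symmetric] by (simp add: powr_realpow)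
  also have "\<dots> = (2 powr (real n * real (L div n))) powr a"
    by (simp add: powr_powr powr_realpow[symmetric] mult_ac)
  also have "real n * real (L div n) \<le> L"
    by (metis of_nat_le_iff of_nat_mult times_div_less_eq_dividend)
  then have "(2 powr (real n * real (L div n))) powr a \<le> (2 powr L) powr a"
    using a by (intro powr_mono2 powr_mono) auto
  also have "2 powr L = real (2 ^ L)" by (simp add: powr_realpow)
  also have "real (2 ^ L) powr a \<le> real (2 * N) powr a"
    using a N by (intro powr_mono2) (auto simp del: of_nat_mult of_nat_power)
  finally show ?thesis by (simp add: a_def powr_mult)
qed

lemma log_power_bound_eventually:
  fixes C D \<epsilon> :: real
  assumes "\<epsilon> > 0" "C \<ge> 0" "D \<ge> 0"
  shows "\<forall>\<^sub>F N::nat in sequentially. C * (D + ln N) ^ 3 \<le> N powr \<epsilon>"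
proof -
  \<comment> \<open>Three of the four quarters of \<open>\<epsilon>\<close> absorb the cube of the
    logarithm, the fourth absorbs the constant.\<close>
  define \<delta> where "\<delta> = \<epsilon> / 4"
  have d: "\<delta> > 0" using assms by (simp add: \<delta>_def)
  define M where "M = max 1 (C * (D + 1 / \<delta>) ^ 3)"
  have "C * (D + 1 / \<delta>) ^ 3 \<le> N powr \<delta>" if "N \<ge> nat \<lceil>M powr (1 / \<delta>)\<rceil>" for N :: nat
  proof -
    have "M powr (1 / \<delta>) \<le> N" using that by linarith
    then have "(M powr (1 / \<delta>)) powr \<delta> \<le> N powr \<delta>" using d by (intro powr_mono2) auto
    then show ?thesis using d by (simp add: powr_powr M_def)
  qed
  then have "\<forall>\<^sub>F N::nat in sequentially. C * (D + 1 / \<delta>) ^ 3 \<le> N powr \<delta>"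
    by (rule eventually_sequentiallyI)
  then show ?thesis using eventually_ge_at_top[of 1]
  proof eventually_elim
    case (elim N)
    have 1: "1 \<le> N powr \<delta>" using elim d by (intro ge_one_powr_ge_zero) auto
    have "ln N \<le> N powr \<delta> / \<delta>" using elim d by (intro ln_powr_bound) auto
    moreover have "D * 1 \<le> D * N powr \<delta>" using assms 1 by (intro mult_left_mono)
    ultimately have "D + ln N \<le> (D + 1 / \<delta>) * N powr \<delta>" by (simp add: algebra_simps)
    moreover have "0 \<le> D + ln N" using assms elim by simp
    ultimately have "C * (D + ln N) ^ 3 \<le> C * ((D + 1 / \<delta>) * N powr \<delta>) ^ 3"
      using assms by (intro mult_left_mono power_mono)
    also have "\<dots> = (C * (D + 1 / \<delta>) ^ 3) * (N powr \<delta>) ^ 3" by (simp add: power_mult_distrib)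
    also have "\<dots> \<le> N powr \<delta> * (N powr \<delta>) ^ 3" using elim by (intro mult_right_mono) auto
    also have "\<dots> = N powr \<epsilon>"
      by (simp add: eval_nat_numeral powr_add[symmetric] \<delta>_def)
    finally show ?case .
  qed
qed

theorem theorem1p1:
  fixes n :: nat
  assumes "n \<ge> 1"
  shows "\<exists>c>0. \<forall>\<alpha>::real. 0 < \<alpha> \<and> \<alpha> < 1 \<and> bounded_cf_coeffs \<alpha> \<longrightarrow>
           (\<forall>\<epsilon>>0. \<forall>\<^sub>F N in sequentially.
              \<bar>real N * star_discrepancy (perturbed_halton_kronecker n \<alpha>) N\<bar>
                \<le> c * \<bar>real N powr (discrepancy_exponent n + \<epsilon>)\<bar>)"
proof (intro exI[of _ 1] conjI allI impI)
  \<comment> \<open>The constant 1 works for every \<open>\<alpha>\<close>: whatever depends on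
    \<open>\<alpha>\<close> is absorbed by \<open>N powr \<epsilon>\<close> once \<open>N\<close> is
    large.\<close>
  fix \<alpha> \<epsilon> :: real
  assume "0 < \<alpha> \<and> \<alpha> < 1 \<and> bounded_cf_coeffs \<alpha>" and eps: "\<epsilon> > 0"
  then obtain c :: real where c: "c > 0" "\<And>(q::nat) (p::int). q \<ge> (1::nat) \<Longrightarrow> c / q \<le> \<bar>q * \<alpha> - p\<bar>"
    using bounded_cf_coeffs_badly_approximable by blast
  define a where "a = discrepancy_exponent n"
  have a: "a \<ge> 1 / 2" unfolding a_def by (rule discrepancy_exponent_ge_half[OF assms])
  \<comment> \<open>The terms stand for the Kronecker error, the twisted sums (4 from
    \<open>3 + 2 * ln Q \<le> 4 * y\<close>), and 2 + 1 for the change of slope and the rounding of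
    the first side.\<close>
  define Ca where "Ca = (12 / c + 3) + (2 ^ (3 * n + 1) * 2 powr a) * 4 + 3"
  \<comment> \<open>Chosen so that \<open>D + ln N\<close> dominates both
    \<open>(L + 1) * ln 2\<close> and \<open>(3 + 2 * ln Q) / 4\<close>.\<close>
  define D where "D = max 2 (3 + 2 * ln (1 / c + 2))"
  have D2: "2 \<le> D" by (simp add: D_def)
  have "\<forall>\<^sub>F N::nat in sequentially. (Ca / ln 2 ^ 3) * (D + ln N) ^ 3 \<le> N powr \<epsilon>"
    by (rule log_power_bound_eventually) (use eps c D2 in \<open>auto simp: Ca_def\<close>)
  then show "\<forall>\<^sub>F N in sequentially.
              \<bar>real N * star_discrepancy (perturbed_halton_kronecker n \<alpha>) N\<bar>
                \<le> 1 * \<bar>real N powr (discrepancy_exponent n + \<epsilon>)\<bar>"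
    using eventually_ge_at_top[of 1]
  proof eventually_elim
    case (elim N)
    obtain L0 where L0: "2 ^ L0 \<le> N" "N < 2 ^ (L0 + 1)" using ex_power_ivl1[of 2 N] elim by auto
    define L where "L = L0 + 1"
    have L: "N < 2 ^ L" "2 ^ L \<le> 2 * N" using L0 by (auto simp: L_def)
    \<comment> \<open>Large enough for the change of slope, yet only quadratic in \<open>N\<close>,
      so that \<open>ln Q\<close> has the order of \<open>ln N\<close>.\<close>
    define Q where "Q = nat \<lceil>N * N / c\<rceil> + N"
    have NNc: "0 \<le> N * N / c" using c by simp
    have Q: "Q \<ge> 1" "N \<le> Q" "real Q \<ge> N * N / c" "real Q \<le> N * N / c + 1 + N"
      unfolding Q_def using elim NNc by (simp, simp, linarith, linarith)
    then have Q3: "N * N \<le> c * Q" using c by (simp add: field_simps)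
    define y where "y = D + ln N"
    have lnN: "ln N \<ge> 0" using elim by simp
    have y: "1 \<le> y" using lnN D2 by (simp add: y_def)
    have l2: "0 < ln (2::real)" "ln (2::real) \<le> 1" using ln_2_less_1 by auto
    have yL: "real L + 1 \<le> y / ln 2"
    proof -
      have "L0 * ln 2 = ln (2 ^ L0)" by (simp add: ln_realpow)
      also have "real (2 ^ L0) \<le> real N" using L0(1) by (rule of_nat_mono)
      then have "ln (2 ^ L0) \<le> ln N" by (intro ln_mono) auto
      finally have "(real L + 1) * ln 2 \<le> ln N + 2 * ln 2" by (simp add: L_def algebra_simps)
      also have "\<dots> \<le> ln N + 2" using l2 by simp
      also have "\<dots> \<le> y" using D2 by (simp add: y_def)
      finally show ?thesis using l2 by (simp add: field_simps)
    qed
    have yQ: "3 + 2 * ln Q \<le> 4 * y"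
    proof -
      have n1: "1 \<le> real N" using elim by simp
      have "1 * real N \<le> real N * real N" using n1 by (intro mult_right_mono) auto
      then have NN: "real N \<le> real N * real N" "1 \<le> real N * real N" using n1 by linarith+
      have "real Q \<le> N * N * (1 / c + 2)" using Q(4) NN by (simp add: algebra_simps)
      then have "ln Q \<le> ln (N * N * (1 / c + 2))" using Q(1) by (intro ln_mono) auto
      also have "0 < 1 / c + 2" using c by (intro add_pos_pos) auto
      then have "ln (N * N * (1 / c + 2)) = 2 * ln N + ln (1 / c + 2)" using elim by (simp add: ln_mult)
      finally have "3 + 2 * ln Q \<le> 4 * ln N + (3 + 2 * ln (1 / c + 2))" by linarith
      also have "3 + 2 * ln (1 / c + 2) \<le> D" by (simp add: D_def)
      then have "4 * ln N + (3 + 2 * ln (1 / c + 2)) \<le> 4 * ln N + 4 * D" using D2 by linarith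
      finally show ?thesis by (simp add: y_def)
    qed
    define P where "P = real N powr a"
    have P: "1 \<le> P" "sqrt N \<le> P"
      unfolding P_def using a elim
      by (auto simp: powr_half_sqrt[symmetric] intro!: ge_one_powr_ge_zero powr_mono)
    define z where "z = y / ln 2"
    have z: "1 \<le> z" "y \<le> z"
    proof -
      have "y * ln 2 \<le> y" using y l2 by (simp add: mult_left_le)
      then show "y \<le> z" using l2 by (simp add: z_def field_simps)
      then show "1 \<le> z" using y by linarith
    qed
    define A where "A = (2::real) ^ (3 * n + 1) * 2 powr a"
    have z3: "z \<le> z ^ 3" "1 \<le> z ^ 3" using z by (auto simp: self_le_power one_le_power)
    have k: "0 \<le> kappa n ^ (L div n)" using kappa_angle(6)[of n] by simp
    have i1: "real L * (2 ^ (3 * n + 1) * kappa n ^ (L div n)) \<le> z * (2 ^ (3 * n + 1) * (2 powr a * P))"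
    proof (rule mult_mono)
      show "(2::real) ^ (3 * n + 1) * kappa n ^ (L div n) \<le> 2 ^ (3 * n + 1) * (2 powr a * P)"
        using kappa_power_div_le[OF assms L(2)] by (intro mult_left_mono) (auto simp: a_def P_def)
    qed (use yL z k in \<open>auto simp: z_def\<close>)
    have "real L * (2 ^ (3 * n + 1) * kappa n ^ (L div n)) * (3 + 2 * ln Q)
        \<le> z * (2 ^ (3 * n + 1) * (2 powr a * P)) * (4 * z)"
      by (rule mult_mono[OF i1]) (use yQ z P Q(1) in auto)
    also have "\<dots> = 4 * A * P * z ^ 2" by (simp add: A_def power2_eq_square)
    finally have i2: "real L * (2 ^ (3 * n + 1) * kappa n ^ (L div n)) * (3 + 2 * ln Q) \<le> 4 * A * P * z ^ 2" .
    have i3: "(12 / c + 3) * sqrt N \<le> (12 / c + 3) * P" using P c by (intro mult_left_mono) auto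
    define G where "G = (12 / c + 3) * sqrt N
      + (real L * (2 ^ (3 * n + 1) * kappa n ^ (L div n)) * (3 + 2 * ln Q) + 2)"
    have G0: "0 \<le> G" unfolding G_def using c k Q(1)
      by (intro add_nonneg_nonneg mult_nonneg_nonneg) auto
    have Gle: "G \<le> (12 / c + 3) * P + (4 * A * P * z ^ 2 + 2 * P)"
      unfolding G_def using i2 i3 P by linarith
    have "(real L + 1) * G \<le> z * ((12 / c + 3) * P + (4 * A * P * z ^ 2 + 2 * P))"
      by (rule mult_mono[OF _ Gle]) (use yL z G0 in \<open>auto simp: z_def\<close>)
    then have "(real L + 1) * G + 1 \<le> z * ((12 / c + 3) * P + (4 * A * P * z ^ 2 + 2 * P)) + P"
      using P by linarith
    also have "\<dots> = z * ((12 / c + 3) * P) + 4 * A * P * z ^ 3 + z * (2 * P) + 1 * P"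
      by (simp add: algebra_simps power3_eq_cube power2_eq_square)
    \<comment> \<open>The cube collects three logarithms: the dyadic levels, the number of partial
      products, and the sum of the Fourier coefficients.\<close>
    also have "\<dots> \<le> z ^ 3 * ((12 / c + 3) * P) + 4 * A * P * z ^ 3 + z ^ 3 * (2 * P) + z ^ 3 * P"
      using z3 P c by (intro add_mono mult_right_mono order.refl) auto
    also have "\<dots> = (Ca * z ^ 3) * P"
      by (simp add: Ca_def A_def algebra_simps)
    also have "Ca * z ^ 3 = (Ca / ln 2 ^ 3) * y ^ 3" by (simp add: z_def power_divide)
    also have "(Ca / ln 2 ^ 3) * y ^ 3 * P \<le> N powr \<epsilon> * P"
      using elim P unfolding y_def by (intro mult_right_mono) auto
    also have "\<dots> = N powr (discrepancy_exponent n + \<epsilon>)"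
      by (simp add: P_def a_def powr_add mult.commute)
    finally show ?case
      using star_discrepancy_bound[OF c Q(1,2) Q3 assms _ L] elim unfolding G_def by simp
  qed
qed simp

end
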